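(* Let $n,s$ be positive integers and let $k$ be a field such that $s_n(k)=\infty$. Then $$w_n(k((x_1))\dots((x_{s-1}))[[x_s]])=w_n(k((x_1))\dots((x_s)))=w_n(k)$$ and $$w_n(k[[x_1,\ldots,x_s]])\geq w_n(k((x_1,\ldots,x_s)))\geq w_n(k).$$
   Context: For a commutative ring $A$ and a positive integer $n$: the $n$th level $s_n(A)$ is the smallest positive integer $g$ such that $-1$ is a sum of $g$ $n$th powers of elements of $A$ ($\infty$ if none); the $n$th Waring number $w_n(A)$ is the smallest positive integer $g$ such that every element of $A$ that is a sum of (finitely many) $n$th powers is a sum of at most $g$ $n$th powers ($\infty$ if none). $k[[x_1,\dots,x_s]]$ is the ring of formal power series, $k((x_1,\dots,x_s))$ is its field of fractions, and $k((x_1))\dots((x_s))$ is the field of iterated formal Laurent series (for $s=1$, $k((x_1))\dots((x_{s-1}))[[x_s]]$ means $k[[x_1]]$). *)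

theory Defs
  imports "HOL-Algebra.Algebra" "HOL-Library.Extended_Nat" "HOL-Library.Poly_Mapping"
begin

section \<open>Levels and Waring numbers\<close>

definition sum_of_npowers :: "('a, 'm) ring_scheme \<Rightarrow> nat \<Rightarrow> nat \<Rightarrow> 'a \<Rightarrow> bool" where
  "sum_of_npowers A n g a \<longleftrightarrow>
     (\<exists>f \<in> {..<g} \<rightarrow> carrier A. a = (\<Oplus>\<^bsub>A\<^esub>i\<in>{..<g}. f i [^]\<^bsub>A\<^esub> n))"

text \<open>The infimum of the empty set in \<^typ>\<open>enat\<close> is \<open>\<infinity>\<close>.\<close>

definition nth_level :: "nat \<Rightarrow> ('a, 'm) ring_scheme \<Rightarrow> enat" where
  "nth_level n A = Inf (enat ` {g. 0 < g \<and> sum_of_npowers A n g (\<ominus>\<^bsub>A\<^esub> \<one>\<^bsub>A\<^esub>)})"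

definition waring_number :: "nat \<Rightarrow> ('a, 'm) ring_scheme \<Rightarrow> enat" where
  "waring_number n A = Inf (enat ` {g. 0 < g \<and>
     (\<forall>a. (\<exists>m. sum_of_npowers A n m a) \<longrightarrow> (\<exists>m\<le>g. sum_of_npowers A n m a))})"

section \<open>Power series and Laurent series in one variable\<close>

definition power_series_ring :: "('a, 'm) ring_scheme \<Rightarrow> (nat \<Rightarrow> 'a) ring" where
  "power_series_ring R = \<lparr>
     carrier = {f. \<forall>i. f i \<in> carrier R},
     monoid.mult = (\<lambda>f g n. \<Oplus>\<^bsub>R\<^esub>i\<in>{..n}. f i \<otimes>\<^bsub>R\<^esub> g (n - i)),
     monoid.one = (\<lambda>n. if n = 0 then \<one>\<^bsub>R\<^esub> else \<zero>\<^bsub>R\<^esub>),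
     ring.zero = (\<lambda>n. \<zero>\<^bsub>R\<^esub>),
     ring.add = (\<lambda>f g n. f n \<oplus>\<^bsub>R\<^esub> g n)\<rparr>"

text \<open>The index set of the convolution sum is restricted to the finitely many \<open>i\<close> for which both
  coefficients are nonzero, since \<^const>\<open>finsum\<close> is only meaningful over finite sets.\<close>

definition laurent_series_ring :: "('a, 'm) ring_scheme \<Rightarrow> (int \<Rightarrow> 'a) ring" where
  "laurent_series_ring R = \<lparr>
     carrier = {f. (\<forall>i. f i \<in> carrier R) \<and> (\<exists>N. \<forall>i<N. f i = \<zero>\<^bsub>R\<^esub>)},
     monoid.mult = (\<lambda>f g n. \<Oplus>\<^bsub>R\<^esub>i\<in>{i. f i \<noteq> \<zero>\<^bsub>R\<^esub> \<and> g (n - i) \<noteq> \<zero>\<^bsub>R\<^esub>}. f i \<otimes>\<^bsub>R\<^esub> g (n - i)),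
     monoid.one = (\<lambda>n. if n = 0 then \<one>\<^bsub>R\<^esub> else \<zero>\<^bsub>R\<^esub>),
     ring.zero = (\<lambda>n. \<zero>\<^bsub>R\<^esub>),
     ring.add = (\<lambda>f g n. f n \<oplus>\<^bsub>R\<^esub> g n)\<rparr>"

section \<open>Iterated Laurent series\<close>

text \<open>Passing from \<open>R\<close> to \<open>R((x))\<close> changes the type of the elements, so in order to iterate \<open>s\<close> times
  the rings are transported along injections into the single type \<^typ>\<open>int list \<Rightarrow> 'a\<close>.  An element of
  \<open>k((x\<^sub>1))\<dots>((x\<^sub>s))\<close> becomes the function sending \<open>[i\<^sub>s, \<dots>, i\<^sub>1]\<close> to its coefficient at
  \<open>x\<^sub>1^i\<^sub>1 \<dots> x\<^sub>s^i\<^sub>s\<close>, and sending lists of other lengths to a dummy value.\<close>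

definition const_coeff :: "'a \<Rightarrow> int list \<Rightarrow> 'a" where
  "const_coeff a = (\<lambda>_. a)"

definition cons_coeff :: "(int \<Rightarrow> int list \<Rightarrow> 'a) \<Rightarrow> int list \<Rightarrow> 'a" where
  "cons_coeff F = (\<lambda>l. case l of [] \<Rightarrow> undefined | i # l' \<Rightarrow> F i l')"

primrec iterated_laurent :: "('a, 'm) ring_scheme \<Rightarrow> nat \<Rightarrow> (int list \<Rightarrow> 'a) ring" where
  "iterated_laurent k 0 = image_ring const_coeff k"
| "iterated_laurent k (Suc s) = image_ring cons_coeff (laurent_series_ring (iterated_laurent k s))"

lemma inj_const_coeff: "inj const_coeff"
  by (auto simp: inj_on_def const_coeff_def fun_eq_iff)

lemma inj_cons_coeff: "inj cons_coeff"
proof (rule injI)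
  fix F G :: "int \<Rightarrow> int list \<Rightarrow> 'a"
  assume eq: "cons_coeff F = cons_coeff G"
  have "F i l = G i l" for i l
    using fun_cong[OF eq, of "i # l"] by (simp add: cons_coeff_def)
  then show "F = G" by blast
qed

lemma iterated_laurent_0_iso: "k \<simeq> iterated_laurent k 0"
  using inj_imp_image_ring_iso[OF inj_on_subset[OF inj_const_coeff subset_UNIV]]
  by (auto simp: is_ring_iso_def)

lemma iterated_laurent_Suc_iso:
  "laurent_series_ring (iterated_laurent k s) \<simeq> iterated_laurent k (Suc s)"
  using inj_imp_image_ring_iso[OF inj_on_subset[OF inj_cons_coeff subset_UNIV]]
  by (auto simp: is_ring_iso_def)

section \<open>Power series in several variables\<close>

text \<open>Monomials are exponent vectors in \<^typ>\<open>nat \<Rightarrow>\<^sub>0 nat\<close>; the variables are indexed by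
  \<open>{1..s}\<close>, and all coefficients at monomials involving other indices vanish.\<close>

definition mpower_series_ring :: "('a, 'm) ring_scheme \<Rightarrow> nat \<Rightarrow> ((nat \<Rightarrow>\<^sub>0 nat) \<Rightarrow> 'a) ring" where
  "mpower_series_ring R s = \<lparr>
     carrier = {f. (\<forall>u. f u \<in> carrier R) \<and>
                   (\<forall>u. \<not> Poly_Mapping.keys u \<subseteq> {1..s} \<longrightarrow> f u = \<zero>\<^bsub>R\<^esub>)},
     monoid.mult = (\<lambda>f g u. \<Oplus>\<^bsub>R\<^esub>p\<in>{p. fst p + snd p = u}. f (fst p) \<otimes>\<^bsub>R\<^esub> g (snd p)),
     monoid.one = (\<lambda>u. if u = 0 then \<one>\<^bsub>R\<^esub> else \<zero>\<^bsub>R\<^esub>),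
     ring.zero = (\<lambda>u. \<zero>\<^bsub>R\<^esub>),
     ring.add = (\<lambda>f g u. f u \<oplus>\<^bsub>R\<^esub> g u)\<rparr>"

section \<open>The field of fractions of a domain\<close>

definition frac_rel :: "('a, 'm) ring_scheme \<Rightarrow> (('a \<times> 'a) \<times> ('a \<times> 'a)) set" where
  "frac_rel R = {((a, b), (c, d)).
     a \<in> carrier R \<and> b \<in> carrier R - {\<zero>\<^bsub>R\<^esub>} \<and> c \<in> carrier R \<and> d \<in> carrier R - {\<zero>\<^bsub>R\<^esub>} \<and>
     a \<otimes>\<^bsub>R\<^esub> d = c \<otimes>\<^bsub>R\<^esub> b}"

definition frac_of :: "('a, 'm) ring_scheme \<Rightarrow> 'a \<Rightarrow> 'a \<Rightarrow> ('a \<times> 'a) set" where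
  "frac_of R a b = frac_rel R `` {(a, b)}"

definition fraction_field :: "('a, 'm) ring_scheme \<Rightarrow> ('a \<times> 'a) set ring" where
  "fraction_field R = \<lparr>
     carrier = (carrier R \<times> (carrier R - {\<zero>\<^bsub>R\<^esub>})) // frac_rel R,
     monoid.mult = (\<lambda>S T. \<Union>(a, b)\<in>S. \<Union>(c, d)\<in>T. frac_of R (a \<otimes>\<^bsub>R\<^esub> c) (b \<otimes>\<^bsub>R\<^esub> d)),
     monoid.one = frac_of R \<one>\<^bsub>R\<^esub> \<one>\<^bsub>R\<^esub>,
     ring.zero = frac_of R \<zero>\<^bsub>R\<^esub> \<one>\<^bsub>R\<^esub>,
     ring.add = (\<lambda>S T. \<Union>(a, b)\<in>S. \<Union>(c, d)\<in>T.
              frac_of R (a \<otimes>\<^bsub>R\<^esub> d \<oplus>\<^bsub>R\<^esub> c \<otimes>\<^bsub>R\<^esub> b) (b \<otimes>\<^bsub>R\<^esub> d))\<rparr>"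

end

theory Submission
  imports Defs
begin

text \<open>
  Infinite level says that a sum of \<open>n\<close>-th powers in \<open>k\<close> vanishes only if every term does.  Hence,
  if \<open>u\<close> is the least exponent occurring in the series \<open>f\<^sub>1, \<dots>, f\<^sub>m\<close>, the coefficient of
  \<open>f\<^sub>1\<^sup>n + \<dots> + f\<^sub>m\<^sup>n\<close> at \<open>n u\<close> is the nonzero sum of the \<open>n\<close>-th powers of the coefficients at \<open>u\<close>:
  nothing cancels.  Three consequences follow for \<open>k((x))\<close>.  The property is inherited,
  so one can iterate.  A sum of \<open>n\<close>-th powers that lies in \<open>k[[x]]\<close> has all its terms there.
  And a sum of \<open>n\<close>-th powers is its leading coefficient times \<open>x\<^bsup>nu\<^esup> (1 + x g)\<close>, where \<open>1 + x g\<close> is an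
  \<open>n\<close>-th power because the characteristic is zero.  For \<open>s\<close> variables, clear denominators in
  \<open>a = \<Sum> (f\<^sub>i / h)\<^sup>n\<close> with \<open>a\<close> constant and compare coefficients at the least exponent for the
  lexicographic order.
\<close>

section \<open>Rings of series\<close>

text \<open>Waring numbers are compared by attaching to an element of one ring a companion in the
  other, such that every representation of the companion returns one of the element with no more
  terms. The companion is an image under an embedding, a numerator, or a leading coefficient. In one
  variable this gives a closed circle of inequalities between the field, its power series and its
  Laurent series. The link from Laurent series back to the field needs every nonzero series to be
  its leading monomial times a unit. In several variables this fails, as for x_1 + x_2, so only
  inequalities are claimed there. Moreover a fraction of series has no constant term to read off,
  hence the comparison of numerators and denominator at one joint least exponent. Characteristic
  zero also comes from the level: in characteristic p, -1 is a sum of p - 1 copies of 1, each an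
  n-th power.\<close>

lemma (in abelian_monoid) finsum_Sigma:
  assumes "finite A" "\<And>x. x \<in> A \<Longrightarrow> finite (B x)"
    and "\<And>x y. x \<in> A \<Longrightarrow> y \<in> B x \<Longrightarrow> g x y \<in> carrier G"
  shows "(\<Oplus>x\<in>A. \<Oplus>y\<in>B x. g x y) = (\<Oplus>z\<in>Sigma A B. g (fst z) (snd z))"
  using assms
proof (induction A rule: finite_induct)
  case empty
  then show ?case by simp
next
  case (insert x A)
  have eq: "Sigma (insert x A) B = Pair x ` B x \<union> Sigma A B"
    by auto
  have "(\<Oplus>z\<in>Sigma (insert x A) B. g (fst z) (snd z)) =
      (\<Oplus>z\<in>Pair x ` B x. g (fst z) (snd z)) \<oplus> (\<Oplus>z\<in>Sigma A B. g (fst z) (snd z))"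
    unfolding eq using insert by (intro finsum_Un_disjoint) auto
  also have "(\<Oplus>z\<in>Pair x ` B x. g (fst z) (snd z)) = (\<Oplus>y\<in>B x. g x y)"
    using insert by (subst finsum_reindex) (auto simp: inj_on_def)
  also have "(\<Oplus>z\<in>Sigma A B. g (fst z) (snd z)) = (\<Oplus>x\<in>A. \<Oplus>y\<in>B x. g x y)"
    using insert by (subst insert.IH) auto
  finally show ?case
    using insert by (subst finsum_insert) (auto intro!: finsum_closed)
qed

text \<open>The family \<open>F\<close> lists the admissible supports; it is what distinguishes power series, Laurent
  series and power series in several variables.\<close>

locale series_ring = R: cring R for R (structure) +
  fixes S :: "('g::{ordered_cancel_comm_monoid_add, linorder} \<Rightarrow> 'a, 'n) ring_scheme"
    and F :: "'g set set"
  assumes carrier_S: "carrier S = {f. (\<forall>u. f u \<in> carrier R) \<and> {u. f u \<noteq> \<zero>} \<in> F}"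
    and mult_S: "\<lbrakk>f \<in> carrier S; g \<in> carrier S\<rbrakk> \<Longrightarrow> (f \<otimes>\<^bsub>S\<^esub> g) u =
      (\<Oplus>p\<in>{p. fst p + snd p = u \<and> f (fst p) \<noteq> \<zero> \<and> g (snd p) \<noteq> \<zero>}. f (fst p) \<otimes> g (snd p))"
    and one_S: "\<one>\<^bsub>S\<^esub> = (\<lambda>u. if u = 0 then \<one> else \<zero>)"
    and zero_S: "\<zero>\<^bsub>S\<^esub> = (\<lambda>u. \<zero>)"
    and add_S: "f \<oplus>\<^bsub>S\<^esub> g = (\<lambda>u. f u \<oplus> g u)"
    and supp_0: "{0} \<in> F"
    and supp_subset: "\<lbrakk>A \<in> F; B \<subseteq> A\<rbrakk> \<Longrightarrow> B \<in> F"
    and supp_Un: "\<lbrakk>A \<in> F; B \<in> F\<rbrakk> \<Longrightarrow> A \<union> B \<in> F"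
    and supp_plus: "\<lbrakk>A \<in> F; B \<in> F\<rbrakk> \<Longrightarrow> {a + b |a b. a \<in> A \<and> b \<in> B} \<in> F"
    and supp_fibre: "\<lbrakk>A \<in> F; B \<in> F\<rbrakk> \<Longrightarrow> finite {p. fst p + snd p = u \<and> fst p \<in> A \<and> snd p \<in> B}"
    and supp_min: "\<lbrakk>A \<in> F; A \<noteq> {}\<rbrakk> \<Longrightarrow> \<exists>u\<in>A. \<forall>v\<in>A. u \<le> v"
begin

section \<open>Ring axioms for series under convolution\<close>

lemma coeff_closed: "f \<in> carrier S \<Longrightarrow> f u \<in> carrier R"
  by (simp add: carrier_S)

lemma supp_in: "f \<in> carrier S \<Longrightarrow> {u. f u \<noteq> \<zero>} \<in> F"
  by (simp add: carrier_S)

lemma carrierI: "\<lbrakk>\<And>u. f u \<in> carrier R; A \<in> F; \<And>u. f u \<noteq> \<zero> \<Longrightarrow> u \<in> A\<rbrakk> \<Longrightarrow> f \<in> carrier S"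
  unfolding carrier_S using supp_subset[of A "{u. f u \<noteq> \<zero>}"] by auto

text \<open>Terms outside the true supports vanish, so the convolution may run over any admissible
  supersets \<open>A\<close> and \<open>B\<close>. This allows several products with different
  supports to be compared over one index set.\<close>

lemma mult_coeff:
  assumes "f \<in> carrier S" "g \<in> carrier S" "A \<in> F" "B \<in> F"
    "\<And>u. f u \<noteq> \<zero> \<Longrightarrow> u \<in> A" "\<And>u. g u \<noteq> \<zero> \<Longrightarrow> u \<in> B"
  shows "(f \<otimes>\<^bsub>S\<^esub> g) u =
    (\<Oplus>p\<in>{p. fst p + snd p = u \<and> fst p \<in> A \<and> snd p \<in> B}. f (fst p) \<otimes> g (snd p))"
  unfolding mult_S[OF assms(1,2)]
proof (rule R.add.finprod_mono_neutral_cong_left)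
  show "finite {p. fst p + snd p = u \<and> fst p \<in> A \<and> snd p \<in> B}"
    using supp_fibre[OF assms(3,4)] .
qed (use assms(1,2,5,6) coeff_closed[OF assms(1)] coeff_closed[OF assms(2)] in \<open>auto simp: Pi_def\<close>)

lemma add_closed: "\<lbrakk>f \<in> carrier S; g \<in> carrier S\<rbrakk> \<Longrightarrow> f \<oplus>\<^bsub>S\<^esub> g \<in> carrier S"
  by (rule carrierI[OF _ supp_Un[OF supp_in[of f] supp_in[of g]]])
     (auto simp: add_S coeff_closed)

lemma zero_closed: "\<zero>\<^bsub>S\<^esub> \<in> carrier S"
  by (rule carrierI[OF _ supp_0]) (auto simp: zero_S)

lemma one_closed: "\<one>\<^bsub>S\<^esub> \<in> carrier S"
  by (rule carrierI[OF _ supp_0]) (auto simp: one_S split: if_splits)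

lemma mult_supp:
  assumes "f \<in> carrier S" "g \<in> carrier S" "(f \<otimes>\<^bsub>S\<^esub> g) u \<noteq> \<zero>"
  shows "u \<in> {a + b |a b. a \<in> {u. f u \<noteq> \<zero>} \<and> b \<in> {u. g u \<noteq> \<zero>}}"
proof (rule ccontr)
  assume "\<not> ?thesis"
  then have *: "{p. fst p + snd p = u \<and> f (fst p) \<noteq> \<zero> \<and> g (snd p) \<noteq> \<zero>} = {}"
    by auto
  show False
    using assms(3) unfolding mult_S[OF assms(1,2)] * by simp
qed

lemma mult_closed:
  assumes "f \<in> carrier S" "g \<in> carrier S"
  shows "f \<otimes>\<^bsub>S\<^esub> g \<in> carrier S"
proof (rule carrierI[OF _ supp_plus[OF supp_in[OF assms(1)] supp_in[OF assms(2)]]])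
  show "(f \<otimes>\<^bsub>S\<^esub> g) u \<in> carrier R" for u
    unfolding mult_S[OF assms] using coeff_closed[OF assms(1)] coeff_closed[OF assms(2)] by (intro R.finsum_closed) auto
qed (rule mult_supp[OF assms])

lemma mult_comm:
  assumes "f \<in> carrier S" "g \<in> carrier S"
  shows "f \<otimes>\<^bsub>S\<^esub> g = g \<otimes>\<^bsub>S\<^esub> f"
proof
  fix u
  let ?P = "{p. fst p + snd p = u \<and> f (fst p) \<noteq> \<zero> \<and> g (snd p) \<noteq> \<zero>}"
  have eq: "{p. fst p + snd p = u \<and> g (fst p) \<noteq> \<zero> \<and> f (snd p) \<noteq> \<zero>} = prod.swap ` ?P"
    by (force simp: image_iff add.commute)
  show "(f \<otimes>\<^bsub>S\<^esub> g) u = (g \<otimes>\<^bsub>S\<^esub> f) u"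
    unfolding mult_S[OF assms] mult_S[OF assms(2,1)] eq
    using coeff_closed[OF assms(1)] coeff_closed[OF assms(2)]
    by (subst R.finsum_reindex) (auto intro!: R.finsum_cong' simp: R.m_comm)
qed

text \<open>The right-hand side treats the three factors alike; associativity is read off from this
  symmetry.\<close>

lemma mult_triple:
  assumes "f \<in> carrier S" "g \<in> carrier S" "h \<in> carrier S"
  shows "((f \<otimes>\<^bsub>S\<^esub> g) \<otimes>\<^bsub>S\<^esub> h) u =
    (\<Oplus>t\<in>{(p, q, r). p + q + r = u \<and> f p \<noteq> \<zero> \<and> g q \<noteq> \<zero> \<and> h r \<noteq> \<zero>}. f (fst t) \<otimes> g (fst (snd t)) \<otimes> h (snd (snd t)))"
    (is "_ = finsum R _ ?T")
proof -
  note [simp] = coeff_closed[OF assms(1)] coeff_closed[OF assms(2)] coeff_closed[OF assms(3)]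
  note sf = supp_in[OF assms(1)] and sg = supp_in[OF assms(2)] and sh = supp_in[OF assms(3)]
  \<comment> \<open>Cancellation can make the support of the product smaller than this sumset.
    Working with the whole sumset keeps the index set independent of such cancellation.\<close>
  let ?W = "{a + b |a b. a \<in> {u. f u \<noteq> \<zero>} \<and> b \<in> {u. g u \<noteq> \<zero>}}"
  let ?X = "{x. fst x + snd x = u \<and> fst x \<in> ?W \<and> snd x \<in> {u. h u \<noteq> \<zero>}}"
  define Y where "Y w = {p. fst p + snd p = w \<and> f (fst p) \<noteq> \<zero> \<and> g (snd p) \<noteq> \<zero>}" for w
  have finY: "finite (Y w)" for w
    using supp_fibre[OF sf sg] by (simp add: Y_def)
  have finX: "finite ?X"
    using supp_fibre[OF supp_plus[OF sf sg] sh] .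
  have "((f \<otimes>\<^bsub>S\<^esub> g) \<otimes>\<^bsub>S\<^esub> h) u = (\<Oplus>x\<in>?X. (f \<otimes>\<^bsub>S\<^esub> g) (fst x) \<otimes> h (snd x))"
    by (rule mult_coeff[OF mult_closed[OF assms(1,2)] assms(3) supp_plus[OF sf sg] sh mult_supp[OF assms(1,2)]])
       auto
  also have "\<dots> = (\<Oplus>x\<in>?X. \<Oplus>y\<in>Y (fst x). f (fst y) \<otimes> g (snd y) \<otimes> h (snd x))"
    using assms mult_S[OF assms(1,2), folded Y_def]
    by (intro R.finsum_cong')
       (auto simp: R.finsum_ldistr finY Pi_def intro!: R.finsum_closed)
  also have "\<dots> = (\<Oplus>z\<in>Sigma ?X (\<lambda>x. Y (fst x)). f (fst (snd z)) \<otimes> g (snd (snd z)) \<otimes> h (snd (fst z)))"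
    using assms by (intro R.finsum_Sigma finX finY) auto
  \<comment> \<open>An outer splitting w + r = u together with an inner one p + q = w is the same
    datum as the triple (p, q, r).\<close>
  also have "Sigma ?X (\<lambda>x. Y (fst x)) = (\<lambda>(p, q, r). ((p + q, r), (p, q))) ` ?T"
    by (force simp: Y_def image_iff)
  also have "(\<Oplus>z\<in>(\<lambda>(p, q, r). ((p + q, r), (p, q))) ` ?T.
      f (fst (snd z)) \<otimes> g (snd (snd z)) \<otimes> h (snd (fst z))) =
      (\<Oplus>t\<in>?T. f (fst t) \<otimes> g (fst (snd t)) \<otimes> h (snd (snd t)))"
    using assms by (subst R.finsum_reindex)
     (auto simp: inj_on_def case_prod_beta intro!: R.finsum_cong')
  finally show ?thesis .
qed

text \<open>By commutativity the right side is (g h) f, so \<open>mult_triple\<close> applies to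
  both sides and a cyclic rotation of triples matches the two sums.\<close>

lemma mult_assoc:
  assumes "f \<in> carrier S" "g \<in> carrier S" "h \<in> carrier S"
  shows "(f \<otimes>\<^bsub>S\<^esub> g) \<otimes>\<^bsub>S\<^esub> h = f \<otimes>\<^bsub>S\<^esub> (g \<otimes>\<^bsub>S\<^esub> h)"
proof
  fix u
  note [simp] = coeff_closed[OF assms(1)] coeff_closed[OF assms(2)] coeff_closed[OF assms(3)]
  let ?T = "{(p, q, r). p + q + r = u \<and> f p \<noteq> \<zero> \<and> g q \<noteq> \<zero> \<and> h r \<noteq> \<zero>}"
  have eq: "{(p, q, r). p + q + r = u \<and> g p \<noteq> \<zero> \<and> h q \<noteq> \<zero> \<and> f r \<noteq> \<zero>} = (\<lambda>(p, q, r). (q, r, p)) ` ?T"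
    by (force simp: image_iff ac_simps)
  have "(f \<otimes>\<^bsub>S\<^esub> (g \<otimes>\<^bsub>S\<^esub> h)) u = ((g \<otimes>\<^bsub>S\<^esub> h) \<otimes>\<^bsub>S\<^esub> f) u"
    by (simp add: mult_comm mult_closed assms)
  also have "\<dots> = (\<Oplus>t\<in>?T. f (fst t) \<otimes> g (fst (snd t)) \<otimes> h (snd (snd t)))"
    unfolding mult_triple[OF assms(2,3,1)] eq using assms
    by (subst R.finsum_reindex)
     (auto simp: inj_on_def case_prod_beta R.m_ac intro!: R.finsum_cong')
  finally show "((f \<otimes>\<^bsub>S\<^esub> g) \<otimes>\<^bsub>S\<^esub> h) u = (f \<otimes>\<^bsub>S\<^esub> (g \<otimes>\<^bsub>S\<^esub> h)) u"
    by (simp add: mult_triple assms)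
qed

lemma const_mult_coeff:
  assumes "a \<in> carrier R" "g \<in> carrier S"
  shows "((\<lambda>u. if u = 0 then a else \<zero>) \<otimes>\<^bsub>S\<^esub> g) u = a \<otimes> g u"
proof -
  define c where "c = (\<lambda>u::'g. if u = 0 then a else \<zero>)"
  have c: "c \<in> carrier S"
    by (rule carrierI[OF _ supp_0]) (use assms in \<open>auto simp: c_def split: if_splits\<close>)
  have c0: "u \<in> {0}" if "c u \<noteq> \<zero>" for u
    using that by (simp add: c_def split: if_splits)
  have eq: "{p. fst p + snd p = u \<and> fst p \<in> {0} \<and> snd p \<in> {u. g u \<noteq> \<zero>}} =
     (if g u = \<zero> then {} else {(0, u)})"
    by auto
  have "(c \<otimes>\<^bsub>S\<^esub> g) u = (\<Oplus>p\<in>(if g u = \<zero> then {} else {(0, u)}). c (fst p) \<otimes> g (snd p))"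
    unfolding eq[symmetric]
    by (rule mult_coeff[OF c assms(2) supp_0 supp_in[OF assms(2)] c0]) simp_all
  then show ?thesis
    using assms(1) coeff_closed[OF assms(2), of u] by (cases "g u = \<zero>") (simp_all add: c_def)
qed

lemma cring_S: "cring S"
proof (rule cringI)
  show "abelian_group S"
  proof (rule abelian_groupI)
    fix f assume f: "f \<in> carrier S"
    show "\<exists>g\<in>carrier S. g \<oplus>\<^bsub>S\<^esub> f = \<zero>\<^bsub>S\<^esub>"
    proof
      show "(\<lambda>u. \<ominus> f u) \<in> carrier S"
        by (rule carrierI[OF _ supp_in[OF f]]) (use coeff_closed[OF f] in auto)
      show "(\<lambda>u. \<ominus> f u) \<oplus>\<^bsub>S\<^esub> f = \<zero>\<^bsub>S\<^esub>"
        using coeff_closed[OF f] by (auto simp: add_S zero_S R.l_neg)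
    qed
  qed (auto simp: add_closed zero_closed, auto simp: add_S zero_S R.a_ac coeff_closed)
  show "comm_monoid S"
  proof (rule comm_monoidI)
    show "\<one>\<^bsub>S\<^esub> \<otimes>\<^bsub>S\<^esub> f = f" if "f \<in> carrier S" for f
      using const_mult_coeff[OF R.one_closed that] coeff_closed[OF that] by (simp add: one_S fun_eq_iff)
  qed (auto simp: mult_closed one_closed mult_assoc intro: mult_comm)
  fix f g h assume *: "f \<in> carrier S" "g \<in> carrier S" "h \<in> carrier S"
  show "(f \<oplus>\<^bsub>S\<^esub> g) \<otimes>\<^bsub>S\<^esub> h = f \<otimes>\<^bsub>S\<^esub> h \<oplus>\<^bsub>S\<^esub> g \<otimes>\<^bsub>S\<^esub> h"
  proof
    fix u
    note [simp] = coeff_closed[OF *(1)] coeff_closed[OF *(2)] coeff_closed[OF *(3)]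
    \<comment> \<open>This set contains the supports of \<open>f\<close>, \<open>g\<close> and their
      sum, so the three convolutions share one index set and can be added termwise.\<close>
    let ?A = "{u. f u \<noteq> \<zero>} \<union> {u. g u \<noteq> \<zero>}"
    have A: "?A \<in> F"
      by (intro supp_Un supp_in *)
    note mc = mult_coeff[OF _ *(3) A supp_in[OF *(3)]]
    have "((f \<oplus>\<^bsub>S\<^esub> g) \<otimes>\<^bsub>S\<^esub> h) u = (f \<otimes>\<^bsub>S\<^esub> h) u \<oplus> (g \<otimes>\<^bsub>S\<^esub> h) u"
      using * supp_fibre[OF A supp_in[OF *(3)]] add_closed[OF *(1,2)]
      by (subst (1 2 3) mc)
         (auto simp: add_S R.l_distr Pi_def simp flip: R.finsum_addf intro!: R.finsum_cong')
    then show "((f \<oplus>\<^bsub>S\<^esub> g) \<otimes>\<^bsub>S\<^esub> h) u = (f \<otimes>\<^bsub>S\<^esub> h \<oplus>\<^bsub>S\<^esub> g \<otimes>\<^bsub>S\<^esub> h) u"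
      by (simp add: add_S)
  qed
qed

sublocale S: cring S
  by (rule cring_S)

section \<open>Coefficients of sums, and leading coefficients of products and powers\<close>

lemma finsum_coeff:
  assumes "f \<in> A \<rightarrow> carrier S"
  shows "(\<Oplus>\<^bsub>S\<^esub>i\<in>A. f i) u = (\<Oplus>i\<in>A. f i u)"
  using assms
proof (induction A rule: infinite_finite_induct)
  case (insert x A)
  then show ?case
    by (simp add: Pi_def coeff_closed) (simp add: add_S)
qed (auto simp: zero_S)

text \<open>If p >= u and q >= v, then p + q = u + v forces p = u and q = v by strict monotonicity
  of addition. The coefficients at \<open>u\<close> and \<open>v\<close> may themselves be zero,
  which lets one exponent serve a whole family of series.\<close>

lemma leading_coeff_mult:
  assumes "f \<in> carrier S" "g \<in> carrier S" "\<And>w. w < u \<Longrightarrow> f w = \<zero>" "\<And>w. w < v \<Longrightarrow> g w = \<zero>"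
  shows "(f \<otimes>\<^bsub>S\<^esub> g) (u + v) = f u \<otimes> g v" and "w < u + v \<Longrightarrow> (f \<otimes>\<^bsub>S\<^esub> g) w = \<zero>"
proof -
  note [simp] = coeff_closed[OF assms(1)] coeff_closed[OF assms(2)]
  have ge: "u \<le> p" "v \<le> q" if "f p \<noteq> \<zero>" "g q \<noteq> \<zero>" for p q
    using assms(3)[of p] assms(4)[of q] that by (metis not_le)+
  have "{p. fst p + snd p = u + v \<and> f (fst p) \<noteq> \<zero> \<and> g (snd p) \<noteq> \<zero>} =
     (if f u = \<zero> \<or> g v = \<zero> then {} else {(u, v)})"
  proof -
    have "p = u \<and> q = v" if "p + q = u + v" "f p \<noteq> \<zero>" "g q \<noteq> \<zero>" for p q
      using ge[OF that(2,3)] that(1) add_less_le_mono[of u p v q] add_le_less_mono[of u p v q]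
      by (metis less_irrefl order_le_less)
    then show ?thesis by auto
  qed
  then show "(f \<otimes>\<^bsub>S\<^esub> g) (u + v) = f u \<otimes> g v"
    using assms(1,2) by (auto simp: mult_S split: if_splits)
  assume w: "w < u + v"
  have "False" if "p + q = w" "f p \<noteq> \<zero>" "g q \<noteq> \<zero>" for p q
    using add_mono[OF ge(1)[OF that(2,3)] ge(2)[OF that(2,3)]] w that(1) by (simp add: leD)
  then have *: "{p. fst p + snd p = w \<and> f (fst p) \<noteq> \<zero> \<and> g (snd p) \<noteq> \<zero>} = {}"
    by auto
  show "(f \<otimes>\<^bsub>S\<^esub> g) w = \<zero>"
    unfolding mult_S[OF assms(1,2)] * by simp
qed

text \<open>The sum of \<open>n\<close> copies of \<open>u\<close> is the multiple n u; it is
  written this way because the exponent type is only an ordered monoid.\<close>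

lemma leading_coeff_pow:
  assumes "f \<in> carrier S" "\<And>w. w < u \<Longrightarrow> f w = \<zero>"
  shows "(f [^]\<^bsub>S\<^esub> n) (\<Sum>_<n. u) = f u [^] n \<and> (\<forall>w < (\<Sum>_<n. u). (f [^]\<^bsub>S\<^esub> (n::nat)) w = \<zero>)"
proof (induction n)
  case 0
  show ?case by (simp add: one_S)
next
  case (Suc n)
  show ?case
    using leading_coeff_mult[OF _ assms(1) _ assms(2), of "f [^]\<^bsub>S\<^esub> n" "\<Sum>_<n. u"] Suc assms(1)
    by (simp add: add.commute)
qed

lemma ex_leading:
  assumes "f \<in> carrier S" "f \<noteq> \<zero>\<^bsub>S\<^esub>"
  obtains u where "f u \<noteq> \<zero>" "\<And>w. w < u \<Longrightarrow> f w = \<zero>"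
proof -
  have "{u. f u \<noteq> \<zero>} \<noteq> {}"
    using assms(2) by (auto simp: zero_S)
  then obtain u where "f u \<noteq> \<zero>" "\<And>v. f v \<noteq> \<zero> \<Longrightarrow> u \<le> v"
    using supp_min[OF supp_in[OF assms(1)]] by blast
  then show ?thesis
    using that leD by metis
qed

text \<open>A finite union of admissible supports is admissible and therefore has a least element.
  Some member is nonzero there, although others may vanish at \<open>u\<close>.\<close>

lemma ex_leading_family:
  assumes "f \<in> {..<g::nat} \<rightarrow> carrier S" "\<exists>i<g. f i \<noteq> \<zero>\<^bsub>S\<^esub>"
  obtains u j where "j < g" "f j u \<noteq> \<zero>" "\<And>i w. i < g \<Longrightarrow> w < u \<Longrightarrow> f i w = \<zero>"
proof -
  have "(\<Union>i<m. {u. f i u \<noteq> \<zero>}) \<in> F" if "m \<le> g" for m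
    using that
  proof (induction m)
    case 0
    then show ?case using supp_subset[OF supp_0] by simp
  next
    case (Suc m)
    have *: "f m \<in> carrier S" using Suc assms by auto
    show ?case
      using Suc supp_Un[OF supp_in[OF *]] by (simp add: lessThan_Suc)
  qed
  then have "(\<Union>i<g. {u. f i u \<noteq> \<zero>}) \<in> F" by simp
  moreover have "(\<Union>i<g. {u. f i u \<noteq> \<zero>}) \<noteq> {}"
    using assms(2) by (auto simp: zero_S fun_eq_iff)
  ultimately obtain u where u: "u \<in> (\<Union>i<g. {u. f i u \<noteq> \<zero>})" "\<forall>v\<in>(\<Union>i<g. {u. f i u \<noteq> \<zero>}). u \<le> v"
    using supp_min by blast
  from u(1) obtain j where "j < g" "f j u \<noteq> \<zero>" by auto
  moreover have "f i w = \<zero>" if "i < g" "w < u" for i w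
    using u(2) that leD by blast
  ultimately show ?thesis using that by blast
qed

lemma leading_coeff_sum_pow:
  assumes "f \<in> A \<rightarrow> carrier S" "\<And>i w. i \<in> A \<Longrightarrow> w < u \<Longrightarrow> f i w = \<zero>"
  shows "(\<Oplus>\<^bsub>S\<^esub>i\<in>A. f i [^]\<^bsub>S\<^esub> n) (\<Sum>_<n. u) = (\<Oplus>i\<in>A. f i u [^] n)"
    and "w < (\<Sum>_<n. u) \<Longrightarrow> (\<Oplus>\<^bsub>S\<^esub>i\<in>A. f i [^]\<^bsub>S\<^esub> (n::nat)) w = \<zero>"
proof -
  have lp: "f i \<in> carrier S" "(f i [^]\<^bsub>S\<^esub> n) (\<Sum>_<n. u) = f i u [^] n"
     "w < (\<Sum>_<n. u) \<Longrightarrow> (f i [^]\<^bsub>S\<^esub> n) w = \<zero>" if "i \<in> A" for i w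
    using that assms leading_coeff_pow[of "f i" u n] by (auto simp: Pi_def)
  show "(\<Oplus>\<^bsub>S\<^esub>i\<in>A. f i [^]\<^bsub>S\<^esub> n) (\<Sum>_<n. u) = (\<Oplus>i\<in>A. f i u [^] n)"
    using lp by (subst finsum_coeff) (auto intro!: R.finsum_cong' simp: coeff_closed)
  assume "w < (\<Sum>_<n. u)"
  then show "(\<Oplus>\<^bsub>S\<^esub>i\<in>A. f i [^]\<^bsub>S\<^esub> n) w = \<zero>"
    using lp by (subst finsum_coeff) (auto intro: R.add.finprod_one_eqI)
qed

text \<open>The product of two leading coefficients is the leading coefficient of the product, so a
  zero divisor among series would produce one in \<open>R\<close>.\<close>

lemma domain_S:
  assumes "domain R"
  shows "domain S"
proof (rule domain.intro[OF cring_S], unfold_locales)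
  interpret R: domain R by fact
  show "\<one>\<^bsub>S\<^esub> \<noteq> \<zero>\<^bsub>S\<^esub>"
    by (auto simp: one_S zero_S dest: fun_cong[where x = 0])
  fix f g assume *: "f \<otimes>\<^bsub>S\<^esub> g = \<zero>\<^bsub>S\<^esub>" "f \<in> carrier S" "g \<in> carrier S"
  show "f = \<zero>\<^bsub>S\<^esub> \<or> g = \<zero>\<^bsub>S\<^esub>"
  proof (rule ccontr)
    assume "\<not> ?thesis"
    then obtain u v where u: "f u \<noteq> \<zero>" "\<And>w. w < u \<Longrightarrow> f w = \<zero>"
      and v: "g v \<noteq> \<zero>" "\<And>w. w < v \<Longrightarrow> g w = \<zero>"
      using ex_leading[OF *(2)] ex_leading[OF *(3)] by metis
    have "f u \<otimes> g v = \<zero>"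
      using leading_coeff_mult(1)[OF *(2,3) u(2) v(2)] *(1) by (simp add: zero_S)
    then show False
      using u(1) v(1) R.integral[OF _ coeff_closed[OF *(2)] coeff_closed[OF *(3)]] by blast
  qed
qed

end

section \<open>Sums of powers\<close>

text \<open>For a field this is equivalent to infinite level, but it makes no reference to \<open>-1\<close> and so
  passes to rings of series by looking at leading coefficients.\<close>

definition npow_anisotropic :: "nat \<Rightarrow> ('a, 'm) ring_scheme \<Rightarrow> bool" where
  "npow_anisotropic n A \<longleftrightarrow> (\<forall>(g::nat) f. f \<in> {..<g} \<rightarrow> carrier A \<longrightarrow>
     (\<Oplus>\<^bsub>A\<^esub>i\<in>{..<g}. f i [^]\<^bsub>A\<^esub> n) = \<zero>\<^bsub>A\<^esub> \<longrightarrow> (\<forall>i<g. f i = \<zero>\<^bsub>A\<^esub>))"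

lemma npow_anisotropicD:
  assumes "npow_anisotropic n A" "f \<in> {..<g::nat} \<rightarrow> carrier A"
    "(\<Oplus>\<^bsub>A\<^esub>i\<in>{..<g}. f i [^]\<^bsub>A\<^esub> n) = \<zero>\<^bsub>A\<^esub>" "i < g"
  shows "f i = \<zero>\<^bsub>A\<^esub>"
  using assms unfolding npow_anisotropic_def by blast

lemma (in domain) nat_pow_eq_zero: "a \<in> carrier R \<Longrightarrow> a [^] (n::nat) = \<zero> \<Longrightarrow> a = \<zero>"
  by (induction n) (auto simp: integral_iff)

lemma (in cring) sum_npow_distrib:
  assumes "f \<in> A \<rightarrow> carrier R" "c \<in> carrier R"
  shows "(\<Oplus>i\<in>A. (c \<otimes> f i) [^] (n::nat)) = c [^] n \<otimes> (\<Oplus>i\<in>A. f i [^] n)"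
proof (cases "finite A")
  case True
  have "(\<Oplus>i\<in>A. (c \<otimes> f i) [^] n) = (\<Oplus>i\<in>A. c [^] n \<otimes> f i [^] n)"
    using assms by (intro finsum_cong') (auto simp: nat_pow_distrib Pi_def)
  then show ?thesis
    using assms True by (subst finsum_rdistr) auto
qed (use assms in simp)

text \<open>Dividing a vanishing sum by a nonzero term \<open>f j [^] n\<close> turns that term into
  1, so that -1 becomes the sum of the remaining n-th powers.\<close>

lemma (in field) npow_anisotropic_if_level_infinite:
  assumes "nth_level n R = \<infinity>" "0 < n"
  shows "npow_anisotropic n R"
  unfolding npow_anisotropic_def
proof (intro allI impI)
  fix g :: nat and f and j
  assume f: "f \<in> {..<g} \<rightarrow> carrier R" and sum: "(\<Oplus>i\<in>{..<g}. f i [^] n) = \<zero>" and j: "j < g"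
  have level: "\<not> sum_of_npowers R n m (\<ominus> \<one>)" if "0 < m" for m
  proof
    assume "sum_of_npowers R n m (\<ominus> \<one>)"
    then have "nth_level n R \<le> enat m"
      unfolding nth_level_def using that by (intro Inf_lower) auto
    with assms show False by simp
  qed
  show "f j = \<zero>"
  proof (rule ccontr)
    assume nz: "f j \<noteq> \<zero>"
    have fi: "f i \<in> carrier R" if "i < g" for i
      using f that by auto
    have fj: "f j \<in> carrier R" using fi j by blast
    then have inv: "inv (f j) \<in> carrier R" "f j \<otimes> inv (f j) = \<one>"
      using nz by (auto simp: field_Units)
    \<comment> \<open>Entry \<open>j\<close> is replaced by zero instead of being removed, so the
      index set stays an initial segment. The new term contributes nothing because 0 to the positive
      power \<open>n\<close> is 0.\<close>
    define h where "h i = (if i = j then \<zero> else inv (f j) \<otimes> f i)" for i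
    have h: "h \<in> {..<g} \<rightarrow> carrier R"
      using fi inv by (auto simp: h_def)
    have "\<zero> = inv (f j) [^] n \<otimes> (\<Oplus>i\<in>{..<g}. f i [^] n)"
      using sum inv by simp
    also have "\<dots> = (\<Oplus>i\<in>{..<g}. (inv (f j) \<otimes> f i) [^] n)"
      using f inv by (simp add: sum_npow_distrib)
    also have "\<dots> = (\<Oplus>i\<in>insert j ({..<g} - {j}). (inv (f j) \<otimes> f i) [^] n)"
      using j by (simp add: insert_absorb)
    also have "\<dots> = \<one> \<oplus> (\<Oplus>i\<in>{..<g} - {j}. (inv (f j) \<otimes> f i) [^] n)"
      using inv f fj by (subst finsum_insert) (auto simp: Pi_def m_comm)
    also have "(\<Oplus>i\<in>{..<g} - {j}. (inv (f j) \<otimes> f i) [^] n) = (\<Oplus>i\<in>{..<g}. h i [^] n)"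
      using h \<open>0 < n\<close> fi inv
      by (intro add.finprod_mono_neutral_cong_left) (auto simp: h_def nat_pow_zero)
    finally have "\<one> \<oplus> (\<Oplus>i\<in>{..<g}. h i [^] n) = \<zero>" ..
    then have "(\<Oplus>i\<in>{..<g}. h i [^] n) = \<ominus> \<one>"
      using h by (intro sum_zero_eq_neg) (auto simp: Pi_def a_comm)
    then have "sum_of_npowers R n g (\<ominus> \<one>)"
      unfolding sum_of_npowers_def using h by (intro bexI[of _ h]) auto
    with level j show False by auto
  qed
qed

text \<open>\<open>N\<close> copies of 1 are \<open>N\<close> nonzero n-th powers, so their sum
  cannot vanish. This provides the division by \<open>n\<close> in root extraction.\<close>

lemma (in cring) char_zero_if_npow_anisotropic:
  assumes "npow_anisotropic n R" "\<one> \<noteq> \<zero>" "0 < N"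
  shows "add_pow R (N::nat) \<one> \<noteq> \<zero>"
proof
  assume "add_pow R N \<one> = \<zero>"
  then have "(\<Oplus>i\<in>{..<N}. \<one> [^] n) = \<zero>"
    by (simp add: add.finprod_const)
  then show False
    using npow_anisotropicD[OF assms(1), of "\<lambda>_. \<one>" N 0] assms by auto
qed

text \<open>Infima reverse inclusion, so it is enough that every bound admissible for
  \<open>A\<close> is admissible for \<open>B\<close>. The companion \<open>a\<close> of
  \<open>b\<close> has a representation within the bound, and this is turned into one of
  \<open>b\<close> of no greater length. Infinite values are covered, since the infimum of the empty
  set is infinity.\<close>

lemma waring_number_le:
  assumes "\<And>m b. sum_of_npowers B n m b \<Longrightarrow>
    \<exists>a. (\<exists>m. sum_of_npowers A n m a) \<and> (\<forall>g. sum_of_npowers A n g a \<longrightarrow> (\<exists>m\<le>g. sum_of_npowers B n m b))"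
  shows "waring_number n B \<le> waring_number n A"
  unfolding waring_number_def
proof (rule Inf_superset_mono, rule image_mono, rule Collect_mono, safe)
  fix g b m
  assume g: "\<forall>a. (\<exists>m. sum_of_npowers A n m a) \<longrightarrow> (\<exists>m\<le>g. sum_of_npowers A n m a)"
    and b: "sum_of_npowers B n m b"
  show "\<exists>m\<le>g. sum_of_npowers B n m b"
    using assms[OF b] g by (meson order_trans)
qed

lemma sum_of_npowers_hom:
  assumes "cring A" "cring B" "h \<in> ring_hom A B" "sum_of_npowers A n m a"
  shows "sum_of_npowers B n m (h a)"
proof -
  interpret ring_hom_cring A B h
    using assms by (simp add: ring_hom_cring_def ring_hom_cring_axioms_def)
  from assms(4) obtain f where f: "f \<in> {..<m} \<rightarrow> carrier A" "a = (\<Oplus>\<^bsub>A\<^esub>i\<in>{..<m}. f i [^]\<^bsub>A\<^esub> n)"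
    unfolding sum_of_npowers_def by blast
  have "h a = (\<Oplus>\<^bsub>B\<^esub>i\<in>{..<m}. h (f i) [^]\<^bsub>B\<^esub> n)"
    unfolding f(2) using f(1) by (subst hom_finsum) (auto intro!: S.finsum_cong' simp: Pi_def)
  then show ?thesis
    unfolding sum_of_npowers_def using f(1) by (intro bexI[of _ "h \<circ> f"]) (auto simp: Pi_def)
qed

lemma sum_of_npowers_carrier:
  assumes "cring A" "sum_of_npowers A n m a"
  shows "a \<in> carrier A"
proof -
  interpret cring A by fact
  show ?thesis
    using assms(2) unfolding sum_of_npowers_def by (auto intro!: finsum_closed simp: Pi_def)
qed

text \<open>The companion of \<open>a\<close> is \<open>h a\<close>: sums of powers go forward along
  \<open>h\<close>, and every representation in \<open>B\<close> returns along \<open>r\<close> with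
  the same number of terms.\<close>

lemma waring_number_retract_le:
  assumes "cring A" "cring B" "h \<in> ring_hom A B" "r \<in> ring_hom B A"
    and "\<And>a. a \<in> carrier A \<Longrightarrow> r (h a) = a"
  shows "waring_number n A \<le> waring_number n B"
  by (rule waring_number_le)
     (metis assms sum_of_npowers_carrier sum_of_npowers_hom order_refl)

lemma waring_number_iso:
  assumes "cring A" "cring B" "h \<in> ring_iso A B"
  shows "waring_number n A = waring_number n B"
proof (rule antisym)
  interpret A: cring A by fact
  have inv: "inv_into (carrier A) h \<in> ring_hom B A"
    using ring_iso_set_sym[OF A.ring_axioms assms(3)] by (simp add: ring_iso_def)
  have h: "h \<in> ring_hom A B" "bij_betw h (carrier A) (carrier B)"
    using assms(3) by (auto simp: ring_iso_def)
  show "waring_number n A \<le> waring_number n B"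
    using waring_number_retract_le[OF assms(1,2) h(1) inv] h(2) by (simp add: bij_betw_inv_into_left)
  show "waring_number n B \<le> waring_number n A"
    using waring_number_retract_le[OF assms(2,1) inv h(1)] h(2) by (simp add: bij_betw_inv_into_right)
qed

text \<open>The factor \<open>c [^] n\<close> is absorbed into the bases, so the number of terms
  does not change.\<close>

lemma (in cring) sum_of_npowers_mult:
  assumes "sum_of_npowers R n g a" "c \<in> carrier R"
  shows "sum_of_npowers R n g (c [^] n \<otimes> a)"
proof -
  from assms(1) obtain f where f: "f \<in> {..<g} \<rightarrow> carrier R" "a = (\<Oplus>i\<in>{..<g}. f i [^] n)"
    unfolding sum_of_npowers_def by blast
  have "c [^] n \<otimes> a = (\<Oplus>i\<in>{..<g}. (c \<otimes> f i) [^] n)"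
    unfolding f(2) using f(1) assms(2) by (rule sum_npow_distrib[symmetric])
  then show ?thesis
    unfolding sum_of_npowers_def using f(1) assms(2)
    by (intro bexI[of _ "\<lambda>i. c \<otimes> f i"]) auto
qed

lemma npow_anisotropic_inj:
  assumes "cring A" "cring B" "h \<in> ring_hom A B" "inj_on h (carrier A)" "npow_anisotropic n B"
  shows "npow_anisotropic n A"
  unfolding npow_anisotropic_def
proof (intro allI impI)
  interpret ring_hom_cring A B h
    using assms by (simp add: ring_hom_cring_def ring_hom_cring_axioms_def)
  fix g :: nat and f j
  assume f: "f \<in> {..<g} \<rightarrow> carrier A" and sum: "(\<Oplus>\<^bsub>A\<^esub>i\<in>{..<g}. f i [^]\<^bsub>A\<^esub> n) = \<zero>\<^bsub>A\<^esub>" and j: "j < g"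
  have fi: "f i \<in> carrier A" if "i < g" for i
    using f that by auto
  have "(\<Oplus>\<^bsub>B\<^esub>i\<in>{..<g}. h (f i) [^]\<^bsub>B\<^esub> n) = h (\<Oplus>\<^bsub>A\<^esub>i\<in>{..<g}. f i [^]\<^bsub>A\<^esub> n)"
    using fi by (subst hom_finsum) (auto intro!: S.finsum_cong')
  then have "h (f j) = \<zero>\<^bsub>B\<^esub>"
    using fi sum by (intro npow_anisotropicD[OF assms(5) _ _ j, of "\<lambda>i. h (f i)"]) auto
  then show "f j = \<zero>\<^bsub>A\<^esub>"
    using inj_onD[OF assms(4), of "f j" "\<zero>\<^bsub>A\<^esub>"] fi[OF j] by simp
qed

context series_ring
begin

lemma npow_anisotropic_S:
  assumes "npow_anisotropic n R"
  shows "npow_anisotropic n S"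
  unfolding npow_anisotropic_def
proof (intro allI impI, rule ccontr)
  fix g :: nat and f k
  assume f: "f \<in> {..<g} \<rightarrow> carrier S" and sum: "(\<Oplus>\<^bsub>S\<^esub>i\<in>{..<g}. f i [^]\<^bsub>S\<^esub> n) = \<zero>\<^bsub>S\<^esub>"
    and "k < g" "f k \<noteq> \<zero>\<^bsub>S\<^esub>"
  then obtain u j where j: "j < g" "f j u \<noteq> \<zero>" and u: "\<And>i w. i < g \<Longrightarrow> w < u \<Longrightarrow> f i w = \<zero>"
    using ex_leading_family[OF f] by metis
  have "(\<Oplus>\<^bsub>S\<^esub>i\<in>{..<g}. f i [^]\<^bsub>S\<^esub> n) (\<Sum>_<n. u) = (\<Oplus>i\<in>{..<g}. f i u [^] n)"
    by (rule leading_coeff_sum_pow(1)[OF f]) (simp add: u)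
  then have "(\<Oplus>i\<in>{..<g}. f i u [^] n) = \<zero>"
    unfolding sum by (simp add: zero_S)
  moreover have "(\<lambda>i. f i u) \<in> {..<g} \<rightarrow> carrier R"
    using f by (auto intro: coeff_closed)
  ultimately have "f j u = \<zero>"
    using npow_anisotropicD[OF assms _ _ j(1), of "\<lambda>i. f i u"] by blast
  with j show False by simp
qed

end

section \<open>Fractions\<close>

context domain
begin

text \<open>Multiplying the desired identity by the middle denominator \<open>d\<close> makes both
  given identities applicable; \<open>d\<close> is then cancelled in the domain.\<close>

lemma frac_rel_trans:
  assumes "a \<in> carrier R" "c \<in> carrier R" "e \<in> carrier R"
    "b \<in> carrier R" "d \<in> carrier R - {\<zero>}" "f \<in> carrier R"
    and "a \<otimes> d = c \<otimes> b" "c \<otimes> f = e \<otimes> d"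
  shows "a \<otimes> f = e \<otimes> b"
proof -
  have "d \<otimes> (a \<otimes> f) = (a \<otimes> d) \<otimes> f"
    using assms(1-6) by (simp add: m_ac)
  also have "\<dots> = (c \<otimes> f) \<otimes> b"
    unfolding assms(7) using assms(1-6) by (simp add: m_ac)
  also have "\<dots> = d \<otimes> (e \<otimes> b)"
    unfolding assms(8) using assms(1-6) by (simp add: m_ac)
  finally show ?thesis
    using assms by (subst (asm) m_lcancel) auto
qed

lemma frac_of_eq_iff:
  assumes "a \<in> carrier R" "b \<in> carrier R - {\<zero>}" "c \<in> carrier R" "d \<in> carrier R - {\<zero>}"
  shows "frac_of R a b = frac_of R c d \<longleftrightarrow> a \<otimes> d = c \<otimes> b"
proof
  assume "frac_of R a b = frac_of R c d"
  moreover have "(c, d) \<in> frac_of R c d"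
    using assms by (simp add: frac_of_def frac_rel_def)
  ultimately have "(c, d) \<in> frac_of R a b" by simp
  then show "a \<otimes> d = c \<otimes> b"
    by (simp add: frac_of_def frac_rel_def)
next
  assume eq: "a \<otimes> d = c \<otimes> b"
  have "(x, y) \<in> frac_of R a b \<longleftrightarrow> (x, y) \<in> frac_of R c d" for x y
  proof -
    have "a \<otimes> y = x \<otimes> b" if "c \<otimes> y = x \<otimes> d" "x \<in> carrier R" "y \<in> carrier R"
      by (rule frac_rel_trans[of a c x b d y]) (use assms eq that in auto)
    moreover have "c \<otimes> y = x \<otimes> d" if "a \<otimes> y = x \<otimes> b" "x \<in> carrier R" "y \<in> carrier R"
      by (rule frac_rel_trans[of c a x d b y]) (use assms eq that in auto)
    ultimately show ?thesis
      unfolding frac_of_def frac_rel_def using assms by blast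
  qed
  then show "frac_of R a b = frac_of R c d" by auto
qed

section \<open>Arithmetic of fractions through representatives\<close>

lemma frac_carrier:
  "x \<in> carrier (fraction_field R) \<longleftrightarrow> (\<exists>a\<in>carrier R. \<exists>b\<in>carrier R - {\<zero>}. x = frac_of R a b)"
  by (auto simp: fraction_field_def frac_of_def quotient_def)

lemma frac_of_closed:
  "\<lbrakk>a \<in> carrier R; b \<in> carrier R - {\<zero>}\<rbrakk> \<Longrightarrow> frac_of R a b \<in> carrier (fraction_field R)"
  by (auto simp: frac_carrier)

lemma frac_ofE:
  assumes "p \<in> frac_of R a b"
  obtains a' b' where "p = (a', b')" "a' \<in> carrier R" "b' \<in> carrier R - {\<zero>}" "a \<otimes> b' = a' \<otimes> b"
  using assms by (auto simp: frac_of_def frac_rel_def)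

lemma denom_mult: "\<lbrakk>b \<in> carrier R - {\<zero>}; d \<in> carrier R - {\<zero>}\<rbrakk> \<Longrightarrow> b \<otimes> d \<in> carrier R - {\<zero>}"
  by (auto simp: integral_iff)

text \<open>The operations of \<open>fraction_field\<close> are unions over all pairs of
  representatives. If every pair contributes the same set, the union over these nonempty classes
  collapses to that set; this is well-definedness in the form required here.\<close>

lemma frac_of_lift2:
  assumes "a \<in> carrier R" "b \<in> carrier R - {\<zero>}" "c \<in> carrier R" "d \<in> carrier R - {\<zero>}"
    and "\<And>a' b' c' d'. \<lbrakk>a' \<in> carrier R; b' \<in> carrier R - {\<zero>}; a \<otimes> b' = a' \<otimes> b;
      c' \<in> carrier R; d' \<in> carrier R - {\<zero>}; c \<otimes> d' = c' \<otimes> d\<rbrakk> \<Longrightarrow> G a' b' c' d' = G a b c d"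
  shows "(\<Union>(a, b)\<in>frac_of R a b. \<Union>(c, d)\<in>frac_of R c d. G a b c d) = G a b c d"
proof -
  have mem: "(a, b) \<in> frac_of R a b" "(c, d) \<in> frac_of R c d"
    using assms(1-4) by (auto simp: frac_of_def frac_rel_def)
  have "(\<Union>(c, d)\<in>frac_of R c d. G a' b' c d) = G a b c d" if "(a', b') \<in> frac_of R a b" for a' b'
  proof (rule SUP_eq_const)
    fix q assume "q \<in> frac_of R c d"
    with that show "(case q of (c, d) \<Rightarrow> G a' b' c d) = G a b c d"
      by (elim frac_ofE) (simp add: assms(5))
  qed (use mem(2) in blast)
  then show ?thesis
    using mem(1) by (intro SUP_eq_const) auto
qed

lemma frac_mult:
  assumes "a \<in> carrier R" "b \<in> carrier R - {\<zero>}" "c \<in> carrier R" "d \<in> carrier R - {\<zero>}"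
  shows "frac_of R a b \<otimes>\<^bsub>fraction_field R\<^esub> frac_of R c d = frac_of R (a \<otimes> c) (b \<otimes> d)"
proof -
  have "(\<Union>(a, b)\<in>frac_of R a b. \<Union>(c, d)\<in>frac_of R c d. frac_of R (a \<otimes> c) (b \<otimes> d)) =
     frac_of R (a \<otimes> c) (b \<otimes> d)"
  proof (rule frac_of_lift2[OF assms])
    fix a' b' c' d'
    assume *: "a' \<in> carrier R" "b' \<in> carrier R - {\<zero>}" "a \<otimes> b' = a' \<otimes> b"
      "c' \<in> carrier R" "d' \<in> carrier R - {\<zero>}" "c \<otimes> d' = c' \<otimes> d"
    have "(a' \<otimes> c') \<otimes> (b \<otimes> d) = (a' \<otimes> b) \<otimes> (c' \<otimes> d)"
      using *(1,2,4,5) assms by (simp add: m_ac)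
    also have "\<dots> = (a \<otimes> c) \<otimes> (b' \<otimes> d')"
      unfolding *(3,6)[symmetric] using *(1,2,4,5) assms by (simp add: m_ac)
    finally show "frac_of R (a' \<otimes> c') (b' \<otimes> d') = frac_of R (a \<otimes> c) (b \<otimes> d)"
      using *(1,2,4,5) assms denom_mult[OF *(2,5)] denom_mult[OF assms(2,4)]
      by (subst frac_of_eq_iff) auto
  qed
  then show ?thesis by (simp add: fraction_field_def)
qed

lemma frac_add:
  assumes "a \<in> carrier R" "b \<in> carrier R - {\<zero>}" "c \<in> carrier R" "d \<in> carrier R - {\<zero>}"
  shows "frac_of R a b \<oplus>\<^bsub>fraction_field R\<^esub> frac_of R c d = frac_of R (a \<otimes> d \<oplus> c \<otimes> b) (b \<otimes> d)"
proof -
  have "(\<Union>(a, b)\<in>frac_of R a b. \<Union>(c, d)\<in>frac_of R c d. frac_of R (a \<otimes> d \<oplus> c \<otimes> b) (b \<otimes> d)) =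
     frac_of R (a \<otimes> d \<oplus> c \<otimes> b) (b \<otimes> d)"
  proof (rule frac_of_lift2[OF assms])
    fix a' b' c' d'
    assume *: "a' \<in> carrier R" "b' \<in> carrier R - {\<zero>}" "a \<otimes> b' = a' \<otimes> b"
      "c' \<in> carrier R" "d' \<in> carrier R - {\<zero>}" "c \<otimes> d' = c' \<otimes> d"
    have "(a' \<otimes> d' \<oplus> c' \<otimes> b') \<otimes> (b \<otimes> d) = (a' \<otimes> b) \<otimes> (d' \<otimes> d) \<oplus> (c' \<otimes> d) \<otimes> (b' \<otimes> b)"
      using *(1,2,4,5) assms by (simp add: l_distr r_distr m_ac)
    also have "\<dots> = (a \<otimes> d \<oplus> c \<otimes> b) \<otimes> (b' \<otimes> d')"
      unfolding *(3,6)[symmetric] using *(1,2,4,5) assms by (simp add: l_distr r_distr m_ac)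
    finally show "frac_of R (a' \<otimes> d' \<oplus> c' \<otimes> b') (b' \<otimes> d') = frac_of R (a \<otimes> d \<oplus> c \<otimes> b) (b \<otimes> d)"
      using *(1,2,4,5) assms denom_mult[OF *(2,5)] denom_mult[OF assms(2,4)]
      by (subst frac_of_eq_iff) auto
  qed
  then show ?thesis by (simp add: fraction_field_def)
qed

text \<open>Sums of powers involve only the additive monoid and iterated multiplication, so the remaining
  field axioms of the field of fractions are not required.\<close>

lemma abelian_monoid_fraction_field: "abelian_monoid (fraction_field R)"
proof (rule abelian_monoidI)
  let ?K = "fraction_field R"
  have zero: "\<zero>\<^bsub>?K\<^esub> = frac_of R \<zero> \<one>"
    by (simp add: fraction_field_def)
  show "\<zero>\<^bsub>?K\<^esub> \<in> carrier ?K"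
    unfolding zero by (rule frac_of_closed) auto
  fix x y z assume "x \<in> carrier ?K" "y \<in> carrier ?K" "z \<in> carrier ?K"
  then obtain a b c d e f where x: "a \<in> carrier R" "b \<in> carrier R - {\<zero>}" "x = frac_of R a b"
    and y: "c \<in> carrier R" "d \<in> carrier R - {\<zero>}" "y = frac_of R c d"
    and z: "e \<in> carrier R" "f \<in> carrier R - {\<zero>}" "z = frac_of R e f"
    unfolding frac_carrier by blast
  note dm = denom_mult[OF x(2) y(2)] denom_mult[OF y(2) z(2)]
  show "x \<oplus>\<^bsub>?K\<^esub> y \<in> carrier ?K"
    using x y dm by (auto simp: frac_add intro!: frac_of_closed)
  show "\<zero>\<^bsub>?K\<^esub> \<oplus>\<^bsub>?K\<^esub> x = x"
    using x by (simp add: zero frac_add)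
  show "x \<oplus>\<^bsub>?K\<^esub> y = y \<oplus>\<^bsub>?K\<^esub> x"
    using x y by (simp add: frac_add a_comm m_comm)
  have "x \<oplus>\<^bsub>?K\<^esub> y \<oplus>\<^bsub>?K\<^esub> z = frac_of R ((a \<otimes> d \<oplus> c \<otimes> b) \<otimes> f \<oplus> e \<otimes> (b \<otimes> d)) ((b \<otimes> d) \<otimes> f)"
    unfolding x(3) y(3) z(3) frac_add[OF x(1,2) y(1,2)]
    by (rule frac_add) (use x y z dm in auto)
  moreover have "x \<oplus>\<^bsub>?K\<^esub> (y \<oplus>\<^bsub>?K\<^esub> z) = frac_of R (a \<otimes> (d \<otimes> f) \<oplus> (c \<otimes> f \<oplus> e \<otimes> d) \<otimes> b) (b \<otimes> (d \<otimes> f))"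
    unfolding x(3) y(3) z(3) frac_add[OF y(1,2) z(1,2)]
    by (rule frac_add) (use x y z dm in auto)
  ultimately show "x \<oplus>\<^bsub>?K\<^esub> y \<oplus>\<^bsub>?K\<^esub> z = x \<oplus>\<^bsub>?K\<^esub> (y \<oplus>\<^bsub>?K\<^esub> z)"
    using x(1,2) y(1,2) z(1,2) by (simp add: l_distr r_distr m_ac a_ac)
qed

lemma denom_pow: "d \<in> carrier R - {\<zero>} \<Longrightarrow> d [^] (n::nat) \<in> carrier R - {\<zero>}"
  using nat_pow_eq_zero by auto

lemma frac_pow:
  assumes "a \<in> carrier R" "b \<in> carrier R - {\<zero>}"
  shows "frac_of R a b [^]\<^bsub>fraction_field R\<^esub> (n::nat) = frac_of R (a [^] n) (b [^] n)"
proof (induction n)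
  case 0
  show ?case by (simp add: nat_pow_def) (simp add: fraction_field_def)
next
  case (Suc n)
  have "frac_of R a b [^]\<^bsub>fraction_field R\<^esub> Suc n =
     (frac_of R a b [^]\<^bsub>fraction_field R\<^esub> n) \<otimes>\<^bsub>fraction_field R\<^esub> frac_of R a b"
    by (simp add: nat_pow_def)
  also have "\<dots> = frac_of R (a [^] Suc n) (b [^] Suc n)"
    unfolding Suc using assms denom_pow[OF assms(2), of n] by (subst frac_mult) auto
  finally show ?case .
qed

lemma frac_finsum:
  assumes "c \<in> A \<rightarrow> carrier R" "d \<in> carrier R - {\<zero>}" "finite A"
  shows "(\<Oplus>\<^bsub>fraction_field R\<^esub>i\<in>A. frac_of R (c i) d) = frac_of R (\<Oplus>i\<in>A. c i) d"
  using assms(3,1)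
proof (induction A rule: finite_induct)
  interpret K: abelian_monoid "fraction_field R" by (rule abelian_monoid_fraction_field)
  case empty
  have "\<zero>\<^bsub>fraction_field R\<^esub> = frac_of R \<zero> d"
    unfolding fraction_field_def using assms frac_of_eq_iff[of \<zero> \<one> \<zero> d] by simp
  then show ?case by simp
next
  interpret K: abelian_monoid "fraction_field R" by (rule abelian_monoid_fraction_field)
  case (insert i A)
  have s: "(\<Oplus>i\<in>A. c i) \<in> carrier R" "c i \<in> carrier R"
    using insert by (auto intro!: finsum_closed simp: Pi_def)
  have "(\<Oplus>\<^bsub>fraction_field R\<^esub>i\<in>insert i A. frac_of R (c i) d) =
     frac_of R (c i) d \<oplus>\<^bsub>fraction_field R\<^esub> frac_of R (\<Oplus>i\<in>A. c i) d"
    using insert assms(2) by (subst K.finsum_insert) (auto intro!: frac_of_closed)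
  also have "\<dots> = frac_of R (c i \<otimes> d \<oplus> (\<Oplus>i\<in>A. c i) \<otimes> d) (d \<otimes> d)"
    using s assms(2) by (subst frac_add) auto
  \<comment> \<open>The addition rule has squared the denominator; one factor \<open>d\<close>
    cancels.\<close>
  also have "\<dots> = frac_of R (c i \<oplus> (\<Oplus>i\<in>A. c i)) d"
    using s assms(2) denom_mult[OF assms(2) assms(2)]
    by (subst frac_of_eq_iff) (auto simp: l_distr r_distr m_ac)
  finally show ?case
    using insert by (subst finsum_insert) auto
qed

text \<open>With one denominator \<open>d\<close> for all fractions, a sum of their n-th powers has
  denominator \<open>d [^] n\<close>, again an n-th power.\<close>

lemma common_denominator:
  assumes "x \<in> {..<g::nat} \<rightarrow> carrier (fraction_field R)"
  obtains c d where "c \<in> {..<g} \<rightarrow> carrier R" "d \<in> carrier R - {\<zero>}"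
    "\<And>i. i < g \<Longrightarrow> x i = frac_of R (c i) d"
proof -
  have "\<exists>c d. c \<in> {..<g} \<rightarrow> carrier R \<and> d \<in> carrier R - {\<zero>} \<and> (\<forall>i<g. x i = frac_of R (c i) d)"
    using assms
  proof (induction g)
    case 0
    show ?case by (rule exI, rule exI[of _ \<one>]) auto
  next
    case (Suc g)
    have "x \<in> {..<g} \<rightarrow> carrier (fraction_field R)"
      using Suc.prems by auto
    then obtain c d where c: "c \<in> {..<g} \<rightarrow> carrier R" and d: "d \<in> carrier R - {\<zero>}"
      and x: "\<And>i. i < g \<Longrightarrow> x i = frac_of R (c i) d"
      using Suc.IH by blast
    have "x g \<in> carrier (fraction_field R)"
      using Suc by auto
    then obtain a b where a: "a \<in> carrier R" and b: "b \<in> carrier R - {\<zero>}" and ab: "x g = frac_of R a b"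
      unfolding frac_carrier by blast
    define c' where "c' i = (if i = g then a \<otimes> d else c i \<otimes> b)" for i
    have "c' \<in> {..<Suc g} \<rightarrow> carrier R"
      using a b c d by (auto simp: c'_def less_Suc_eq Pi_def)
    moreover have "x i = frac_of R (c' i) (d \<otimes> b)" if "i < Suc g" for i
    proof (cases "i = g")
      case True
      then show ?thesis
        using a b d denom_mult[OF d b] unfolding ab True
        by (subst frac_of_eq_iff) (auto simp: c'_def m_ac)
    next
      case False
      then have "i < g" using that by simp
      then have "c i \<in> carrier R" using c by auto
      then show ?thesis
        using b d denom_mult[OF d b] False unfolding x[OF \<open>i < g\<close>]
        by (subst frac_of_eq_iff) (auto simp: c'_def m_ac)
    qed
    ultimately show ?case using denom_mult[OF d b] by blast
  qed
  then show ?thesis using that by blast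
qed

lemma frac_sum_pow:
  assumes "c \<in> {..<g::nat} \<rightarrow> carrier R" "d \<in> carrier R - {\<zero>}"
    "\<And>i. i < g \<Longrightarrow> x i = frac_of R (c i) d"
  shows "(\<Oplus>\<^bsub>fraction_field R\<^esub>i\<in>{..<g}. x i [^]\<^bsub>fraction_field R\<^esub> n) =
    frac_of R (\<Oplus>i\<in>{..<g}. c i [^] (n::nat)) (d [^] n)"
proof -
  interpret K: abelian_monoid "fraction_field R" by (rule abelian_monoid_fraction_field)
  have "(\<Oplus>\<^bsub>fraction_field R\<^esub>i\<in>{..<g}. x i [^]\<^bsub>fraction_field R\<^esub> n) =
    (\<Oplus>\<^bsub>fraction_field R\<^esub>i\<in>{..<g}. frac_of R (c i [^] n) (d [^] n))"
    using assms denom_pow[OF assms(2), of n]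
    by (intro K.finsum_cong') (auto simp: frac_pow Pi_def intro!: frac_of_closed)
  also have "\<dots> = frac_of R (\<Oplus>i\<in>{..<g}. c i [^] n) (d [^] n)"
    using assms denom_pow[OF assms(2), of n] by (intro frac_finsum) auto
  finally show ?thesis .
qed

text \<open>The companion is the numerator over a common denominator. Any representation of the
  numerator in \<open>R\<close>, divided termwise by \<open>d\<close>, represents the fraction with
  equally many terms.\<close>

lemma waring_number_fraction_field_le: "waring_number n (fraction_field R) \<le> waring_number n R"
proof (rule waring_number_le)
  fix m b
  assume "sum_of_npowers (fraction_field R) n m b"
  then obtain x where x: "x \<in> {..<m} \<rightarrow> carrier (fraction_field R)"
    "b = (\<Oplus>\<^bsub>fraction_field R\<^esub>i\<in>{..<m}. x i [^]\<^bsub>fraction_field R\<^esub> n)"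
    unfolding sum_of_npowers_def by blast
  obtain c d where c: "c \<in> {..<m} \<rightarrow> carrier R" and d: "d \<in> carrier R - {\<zero>}"
    and cd: "\<And>i. i < m \<Longrightarrow> x i = frac_of R (c i) d"
    using common_denominator[OF x(1)] by blast
  let ?a = "\<Oplus>i\<in>{..<m}. c i [^] n"
  have b: "b = frac_of R ?a (d [^] n)"
    unfolding x(2) by (rule frac_sum_pow[OF c d cd])
  have "sum_of_npowers (fraction_field R) n g b" if "sum_of_npowers R n g ?a" for g
  proof -
    from that obtain c' where c': "c' \<in> {..<g} \<rightarrow> carrier R" "?a = (\<Oplus>i\<in>{..<g}. c' i [^] n)"
      unfolding sum_of_npowers_def by blast
    have "b = (\<Oplus>\<^bsub>fraction_field R\<^esub>i\<in>{..<g}. frac_of R (c' i) d [^]\<^bsub>fraction_field R\<^esub> n)"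
      unfolding b c'(2) by (rule frac_sum_pow[OF c'(1) d refl, symmetric])
    then show ?thesis
      unfolding sum_of_npowers_def using c'(1) d
      by (intro bexI[of _ "\<lambda>i. frac_of R (c' i) d"]) (auto intro!: frac_of_closed)
  qed
  moreover have "sum_of_npowers R n m ?a"
    unfolding sum_of_npowers_def using c by blast
  ultimately show "\<exists>a. (\<exists>m. sum_of_npowers R n m a) \<and>
      (\<forall>g. sum_of_npowers R n g a \<longrightarrow> (\<exists>m\<le>g. sum_of_npowers (fraction_field R) n m b))"
    by blast
qed

end

section \<open>Constants inside the fraction field of a ring of series\<close>

context series_ring
begin

definition const_series :: "'a \<Rightarrow> 'g \<Rightarrow> 'a" where
  "const_series a = (\<lambda>u. if u = 0 then a else \<zero>)"

lemma const_series_hom: "const_series \<in> ring_hom R S"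
proof (rule ring_hom_memI)
  show c: "const_series a \<in> carrier S" if "a \<in> carrier R" for a
    by (rule carrierI[OF _ supp_0]) (use that in \<open>auto simp: const_series_def split: if_splits\<close>)
  show "const_series (a \<otimes> b) = const_series a \<otimes>\<^bsub>S\<^esub> const_series b" if "a \<in> carrier R" "b \<in> carrier R" for a b
    using const_mult_coeff[OF that(1) c[OF that(2)]] that
    by (auto simp: fun_eq_iff const_series_def)
qed (auto simp: const_series_def add_S one_S)

lemma waring_number_le_fraction_field:
  assumes "field R" "npow_anisotropic n R" "0 < n"
  shows "waring_number n R \<le> waring_number n (fraction_field S)"
proof (rule waring_number_le)
  interpret R: field R by fact
  interpret S: domain S by (rule domain_S) (rule R.domain_axioms)
  fix m b assume b: "sum_of_npowers R n m b"
  then have bR: "b \<in> carrier R"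
    using sum_of_npowers_carrier[OF R.is_cring] by blast
  have "sum_of_npowers S n m (const_series b)"
    by (rule sum_of_npowers_hom[OF R.is_cring S.is_cring const_series_hom b])
  then obtain c where c: "c \<in> {..<m} \<rightarrow> carrier S" "const_series b = (\<Oplus>\<^bsub>S\<^esub>i\<in>{..<m}. c i [^]\<^bsub>S\<^esub> n)"
    unfolding sum_of_npowers_def by blast
  have bS: "const_series b \<in> carrier S"
    using ring_hom_closed[OF const_series_hom bR] .
  let ?a = "frac_of S (const_series b) \<one>\<^bsub>S\<^esub>"
  have "?a = (\<Oplus>\<^bsub>fraction_field S\<^esub>i\<in>{..<m}. frac_of S (c i) \<one>\<^bsub>S\<^esub> [^]\<^bsub>fraction_field S\<^esub> n)"
    using S.frac_sum_pow[OF c(1), of "\<one>\<^bsub>S\<^esub>"] c(2) by simp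
  then have "sum_of_npowers (fraction_field S) n m ?a"
    unfolding sum_of_npowers_def using c
    by (intro bexI[of _ "\<lambda>i. frac_of S (c i) \<one>\<^bsub>S\<^esub>"]) (auto intro!: S.frac_of_closed)
  moreover have "sum_of_npowers R n g b" if sum: "sum_of_npowers (fraction_field S) n g ?a" for g
  proof -
    from sum obtain x where x: "x \<in> {..<g} \<rightarrow> carrier (fraction_field S)"
      "?a = (\<Oplus>\<^bsub>fraction_field S\<^esub>i\<in>{..<g}. x i [^]\<^bsub>fraction_field S\<^esub> n)"
      unfolding sum_of_npowers_def by blast
    obtain c d where c: "c \<in> {..<g} \<rightarrow> carrier S" and d: "d \<in> carrier S - {\<zero>\<^bsub>S\<^esub>}"
      and cd: "\<And>i. i < g \<Longrightarrow> x i = frac_of S (c i) d"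
      using S.common_denominator[OF x(1)] by blast
    have dn: "d [^]\<^bsub>S\<^esub> n \<in> carrier S - {\<zero>\<^bsub>S\<^esub>}"
      by (rule S.denom_pow[OF d])
    have sumS: "(\<Oplus>\<^bsub>S\<^esub>i\<in>{..<g}. c i [^]\<^bsub>S\<^esub> n) \<in> carrier S"
      using c by (auto intro!: S.finsum_closed)
    have "?a = frac_of S (\<Oplus>\<^bsub>S\<^esub>i\<in>{..<g}. c i [^]\<^bsub>S\<^esub> n) (d [^]\<^bsub>S\<^esub> n)"
      unfolding x(2) by (rule S.frac_sum_pow[OF c d cd])
    then have eq: "const_series b \<otimes>\<^bsub>S\<^esub> d [^]\<^bsub>S\<^esub> n = (\<Oplus>\<^bsub>S\<^esub>i\<in>{..<g}. c i [^]\<^bsub>S\<^esub> n)"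
      using bS dn sumS by (subst (asm) S.frac_of_eq_iff) auto
    \<comment> \<open>The denominator joins the numerators as entry \<open>g\<close>, so that
      \<open>u\<close> is the least exponent of all of them together and both sides of
      \<open>eq\<close> can be read at n u.\<close>
    define f where "f i = (if i = g then d else c i)" for i
    have f: "f \<in> {..<Suc g} \<rightarrow> carrier S"
      using c d by (auto simp: f_def less_Suc_eq)
    have "\<exists>i<Suc g. f i \<noteq> \<zero>\<^bsub>S\<^esub>"
      using d by (intro exI[of _ g]) (auto simp: f_def)
    then obtain u j where j: "j < Suc g" "f j u \<noteq> \<zero>" and u: "\<And>i w. i < Suc g \<Longrightarrow> w < u \<Longrightarrow> f i w = \<zero>"
      using ex_leading_family[OF f] by metis
    have cu: "c i w = \<zero>" if "i < g" "w < u" for i w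
      using u[of i w] that by (auto simp: f_def)
    have du: "d w = \<zero>" if "w < u" for w
      using u[of g w] that by (auto simp: f_def)
    have ci: "c i u \<in> carrier R" if "i < g" for i
      using c that coeff_closed by auto
    have dc: "d u \<in> carrier R"
      using d coeff_closed by auto
    have "(const_series b \<otimes>\<^bsub>S\<^esub> d [^]\<^bsub>S\<^esub> n) (\<Sum>_<n. u) = b \<otimes> d u [^] n"
      using const_mult_coeff[OF bR, of "d [^]\<^bsub>S\<^esub> n"] leading_coeff_pow[of d u n] du dn d
      by (simp add: const_series_def)
    moreover have "(\<Oplus>\<^bsub>S\<^esub>i\<in>{..<g}. c i [^]\<^bsub>S\<^esub> n) (\<Sum>_<n. u) = (\<Oplus>i\<in>{..<g}. c i u [^] n)"
      using cu by (intro leading_coeff_sum_pow(1)[OF c]) auto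
    ultimately have key: "b \<otimes> d u [^] n = (\<Oplus>i\<in>{..<g}. c i u [^] n)"
      using eq by simp
    \<comment> \<open>If \<open>d u\<close> vanished, the n-th powers of the \<open>c i u\<close>
      would sum to zero, and anisotropy would make all of them zero. Then nothing in the family
      would be nonzero at \<open>u\<close>, contradicting the choice of \<open>u\<close>.\<close>
    have nz: "d u \<noteq> \<zero>"
    proof
      assume z: "d u = \<zero>"
      then have "(\<Oplus>i\<in>{..<g}. c i u [^] n) = \<zero>"
        using key bR \<open>0 < n\<close> by (simp add: R.nat_pow_zero)
      then have "c i u = \<zero>" if "i < g" for i
        using ci that by (intro npow_anisotropicD[OF assms(2), of "\<lambda>i. c i u" g]) auto
      then show False
        using j z by (auto simp: f_def less_Suc_eq split: if_splits)
    qed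
    then have inv: "inv (d u) \<in> carrier R" "inv (d u) \<otimes> d u = \<one>"
      using dc by (auto simp: R.field_Units)
    have "(\<Oplus>i\<in>{..<g}. (inv (d u) \<otimes> c i u) [^] n) = inv (d u) [^] n \<otimes> (b \<otimes> d u [^] n)"
      unfolding key using inv ci by (intro R.sum_npow_distrib) auto
    also have "\<dots> = b \<otimes> (inv (d u) \<otimes> d u) [^] n"
      using inv(1) bR dc by (simp add: R.nat_pow_distrib R.m_ac)
    also have "\<dots> = b"
      using inv bR by simp
    finally show ?thesis
      unfolding sum_of_npowers_def using inv ci by (intro bexI[of _ "\<lambda>i. inv (d u) \<otimes> c i u"]) auto
  qed
  ultimately show "\<exists>a. (\<exists>m. sum_of_npowers (fraction_field S) n m a) \<and>
      (\<forall>g. sum_of_npowers (fraction_field S) n g a \<longrightarrow> (\<exists>m\<le>g. sum_of_npowers R n m b))"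
    by blast
qed

end

section \<open>The three rings of series\<close>

text \<open>Every set of natural numbers is an admissible support: a number has finitely many
  splittings, and nonempty sets have least elements.\<close>

lemma series_ring_power_series_ring:
  fixes R (structure)
  assumes "cring R"
  shows "series_ring R (power_series_ring R) UNIV"
proof -
  interpret cring R by fact
  have fin: "finite {p::nat \<times> nat. fst p + snd p = u}" for u
    by (rule finite_subset[of _ "{..u} \<times> {..u}"]) auto
  show ?thesis
  proof (unfold_locales, goal_cases)
    case (2 f g u)
    then have c: "f i \<in> carrier R" "g i \<in> carrier R" for i
      by (auto simp: power_series_ring_def)
    have "(\<lambda>i. (i, u - i)) ` {..u} = {p. fst p + snd p = u}"
      by (auto simp: image_iff)
    then have "(f \<otimes>\<^bsub>power_series_ring R\<^esub> g) u = (\<Oplus>p\<in>{p. fst p + snd p = u}. f (fst p) \<otimes> g (snd p))"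
      unfolding power_series_ring_def using c
      by (subst \<open>_ = {p. fst p + snd p = u}\<close>[symmetric], subst finsum_reindex)
         (auto simp: inj_on_def Pi_def)
    also have "\<dots> = (\<Oplus>p\<in>{p. fst p + snd p = u \<and> f (fst p) \<noteq> \<zero> \<and> g (snd p) \<noteq> \<zero>}. f (fst p) \<otimes> g (snd p))"
      using c by (intro add.finprod_mono_neutral_cong_right fin) auto
    finally show ?case .
  next
    case (10 A B u)
    show ?case by (rule finite_subset[OF _ fin[of u]]) auto
  next
    case (11 A)
    then obtain a where "a \<in> A" by blast
    then show ?case
      using LeastI[of "\<lambda>i. i \<in> A" a] Least_le[of "\<lambda>i. i \<in> A"]
      by (intro bexI[of _ "LEAST i. i \<in> A"]) auto
  qed (auto simp: power_series_ring_def)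
qed

lemma series_ring_laurent_series_ring:
  fixes R (structure)
  assumes "cring R"
  shows "series_ring R (laurent_series_ring R) {A. \<exists>N. \<forall>i\<in>A. N \<le> i}"
proof -
  interpret cring R by fact
  show ?thesis
  proof (unfold_locales, goal_cases)
    case 1
    show ?case
      unfolding laurent_series_ring_def
      by (auto intro!: Collect_cong) (metis linorder_not_less)+
  next
    case (2 f g u)
    then have c: "f i \<in> carrier R" "g i \<in> carrier R" for i
      by (auto simp: laurent_series_ring_def)
    have eq: "{p. fst p + snd p = u \<and> f (fst p) \<noteq> \<zero> \<and> g (snd p) \<noteq> \<zero>} =
        (\<lambda>i. (i, u - i)) ` {i. f i \<noteq> \<zero> \<and> g (u - i) \<noteq> \<zero>}"
      by (auto simp: image_iff)
    show ?case
      unfolding eq using c by (subst finsum_reindex) (auto simp: inj_on_def laurent_series_ring_def)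
  next
    case (8 A B)
    then obtain N M where "\<forall>i\<in>A. N \<le> i" "\<forall>i\<in>B. M \<le> i" by blast
    then show ?case by (auto intro!: exI[of _ "min N M"])
  next
    case (9 A B)
    then obtain N M where "\<forall>i\<in>A. N \<le> i" "\<forall>i\<in>B. M \<le> i" by blast
    then show ?case by (auto intro!: exI[of _ "N + M"] add_mono)
  next
    case (10 A B u)
    then obtain N M where "\<forall>i\<in>A. N \<le> i" "\<forall>i\<in>B. M \<le> i" by blast
    \<comment> \<open>The lower bounds \<open>N\<close> and \<open>M\<close> bound each summand from
      above as well, because the sum is fixed.\<close>
    then have "{p. fst p + snd p = u \<and> fst p \<in> A \<and> snd p \<in> B} \<subseteq> {N..u - M} \<times> {M..u - N}"
      by (auto simp: le_diff_eq)
    then show ?case by (rule finite_subset) auto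
  next
    case (11 A)
    then obtain N a where N: "\<forall>i\<in>A. N \<le> i" and "a \<in> A" by blast
    \<comment> \<open>Shifting by the lower bound \<open>N\<close> transfers the question to the
      natural numbers, where a minimum exists.\<close>
    then obtain i where "i \<in> A" "\<forall>j. j \<in> A \<longrightarrow> nat (i - N) \<le> nat (j - N)"
      using ex_has_least_nat[of "\<lambda>i. i \<in> A" a "\<lambda>i. nat (i - N)"] by auto
    then show ?case using N by (intro bexI[of _ i]) (auto simp: nat_le_eq_zle)
  qed (auto simp: laurent_series_ring_def)
qed

text \<open>The first summand determines the second, is bounded pointwise by \<open>u\<close>, and
  vanishes off the finitely many keys of \<open>u\<close>. Its restriction to these keys therefore
  lies in a finite product of intervals.\<close>

lemma finite_poly_mapping_add_eq: "finite {p::('b \<Rightarrow>\<^sub>0 nat) \<times> ('b \<Rightarrow>\<^sub>0 nat). fst p + snd p = u}"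
proof -
  let ?P = "{p::('b \<Rightarrow>\<^sub>0 nat) \<times> ('b \<Rightarrow>\<^sub>0 nat). fst p + snd p = u}"
  let ?h = "\<lambda>p :: ('b \<Rightarrow>\<^sub>0 nat) \<times> ('b \<Rightarrow>\<^sub>0 nat). restrict (Poly_Mapping.lookup (fst p)) (Poly_Mapping.keys u)"
  have le: "Poly_Mapping.lookup (fst p) x \<le> Poly_Mapping.lookup u x" if "p \<in> ?P" for p x
    using that by (auto simp: lookup_add)
  have "inj_on ?h ?P"
  proof (rule inj_onI)
    fix p q assume *: "p \<in> ?P" "q \<in> ?P" "?h p = ?h q"
    have "Poly_Mapping.lookup (fst p) x = Poly_Mapping.lookup (fst q) x" for x
    proof (cases "x \<in> Poly_Mapping.keys u")
      case True
      then show ?thesis using fun_cong[OF *(3), of x] by simp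
    next
      case False
      then show ?thesis using le[OF *(1), of x] le[OF *(2), of x] by (simp add: in_keys_iff)
    qed
    then have "fst p = fst q" by (rule poly_mapping_eqI)
    then show "p = q" using * by (auto simp: prod_eq_iff)
  qed
  moreover have "?h ` ?P \<subseteq> (\<Pi>\<^sub>E x\<in>Poly_Mapping.keys u. {..Poly_Mapping.lookup u x})"
    using le by auto
  then have "finite (?h ` ?P)"
    by (rule finite_subset) (auto intro!: finite_PiE)
  ultimately show ?thesis using finite_imageD by blast
qed

text \<open>The order is lexicographic with the smallest index most significant. Over infinitely
  many variables it is not well-founded: the unit vectors e_1 > e_2 > ... descend forever. With
  indices confined to \<open>{1..s}\<close> it embeds into the lexicographic order on lists of
  length \<open>s\<close>.\<close>

lemma wf_less_poly_mapping_bounded_keys: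
  "wf {(u, v :: nat \<Rightarrow>\<^sub>0 nat). u < v \<and> Poly_Mapping.keys v \<subseteq> {1..s}}"
proof (rule wf_subset)
  let ?l = "\<lambda>u :: nat \<Rightarrow>\<^sub>0 nat. map (Poly_Mapping.lookup u) [1..<Suc s]"
  show "wf (inv_image (lexn less_than s) ?l)"
    by (intro wf_inv_image wf_lexn wf_less_than)
  show "{(u, v). u < v \<and> Poly_Mapping.keys v \<subseteq> {1..s}} \<subseteq> inv_image (lexn less_than s) ?l"
  proof clarify
    fix u v :: "nat \<Rightarrow>\<^sub>0 nat" assume "u < v" and keys: "Poly_Mapping.keys v \<subseteq> {1..s}"
    then obtain j where j: "Poly_Mapping.lookup u j < Poly_Mapping.lookup v j"
      "\<And>i. i < j \<Longrightarrow> Poly_Mapping.lookup u i = Poly_Mapping.lookup v i"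
      by (auto simp: less_poly_mapping.rep_eq less_fun_def)
    \<comment> \<open>At the first difference the larger vector has a positive entry, so this index
      is a key of \<open>v\<close> and lies in \<open>{1..s}\<close>.\<close>
    from j(1) have "j \<in> Poly_Mapping.keys v"
      by (auto simp: in_keys_iff)
    with keys have js: "1 \<le> j" "j \<le> s" by auto
    then have "[1..<Suc s] = [1..<j] @ j # [Suc j..<Suc s]"
      using upt_add_eq_append[of 1 j "Suc s - j"] upt_conv_Cons[of j "Suc s"] by simp
    then have l: "?l w = map (Poly_Mapping.lookup w) [1..<j] @ Poly_Mapping.lookup w j #
        map (Poly_Mapping.lookup w) [Suc j..<Suc s]" for w :: "nat \<Rightarrow>\<^sub>0 nat"
      by simp
    have eq: "map (Poly_Mapping.lookup u) [1..<j] = map (Poly_Mapping.lookup v) [1..<j]"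
      using j(2) by simp
    have "(?l u, ?l v) \<in> lexn less_than s"
      unfolding lexn_conv mem_Collect_eq case_prod_conv
    proof (intro conjI exI)
      show "?l u = map (Poly_Mapping.lookup v) [1..<j] @ Poly_Mapping.lookup u j #
        map (Poly_Mapping.lookup u) [Suc j..<Suc s]"
        using l[of u] unfolding eq .
      show "?l v = map (Poly_Mapping.lookup v) [1..<j] @ Poly_Mapping.lookup v j #
        map (Poly_Mapping.lookup v) [Suc j..<Suc s]"
        by (rule l)
    qed (use j(1) in \<open>simp_all del: upt_Suc\<close>)
    then show "(u, v) \<in> inv_image (lexn less_than s) ?l"
      by (simp add: in_inv_image del: upt_Suc)
  qed
qed

lemma series_ring_mpower_series_ring:
  fixes R (structure)
  assumes "cring R"
  shows "series_ring R (mpower_series_ring R s) (Pow {u. Poly_Mapping.keys u \<subseteq> {1..s}})"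
proof -
  interpret cring R by fact
  show ?thesis
  proof (unfold_locales, goal_cases)
    case 1
    show ?case
      by (auto simp: mpower_series_ring_def)
  next
    case (2 f g u)
    then have c: "f i \<in> carrier R" "g i \<in> carrier R" for i
      by (auto simp: mpower_series_ring_def)
    have "(f \<otimes>\<^bsub>mpower_series_ring R s\<^esub> g) u = (\<Oplus>p\<in>{p. fst p + snd p = u}. f (fst p) \<otimes> g (snd p))"
      by (simp add: mpower_series_ring_def)
    also have "\<dots> = (\<Oplus>p\<in>{p. fst p + snd p = u \<and> f (fst p) \<noteq> \<zero> \<and> g (snd p) \<noteq> \<zero>}. f (fst p) \<otimes> g (snd p))"
      using c by (intro add.finprod_mono_neutral_cong_right finite_poly_mapping_add_eq) auto
    finally show ?case .
  next
    case (9 A B)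
    then show ?case by (auto dest!: subsetD[OF Poly_Mapping.keys_add])
  next
    case (10 A B u)
    show ?case by (rule finite_subset[OF _ finite_poly_mapping_add_eq[of u]]) auto
  next
    case (11 A)
    then obtain a where "a \<in> A" by blast
    then obtain u where u: "u \<in> A"
      "\<And>v. (v, u) \<in> {(u, v). u < v \<and> Poly_Mapping.keys v \<subseteq> {1..s}} \<Longrightarrow> v \<notin> A"
      by (rule wfE_min[OF wf_less_poly_mapping_bounded_keys[of s]]) blast
    moreover have "Poly_Mapping.keys u \<subseteq> {1..s}"
      using 11 u(1) by blast
    ultimately have "u \<le> v" if "v \<in> A" for v
      using that by (intro leI) auto
    with u(1) show ?case by blast
  qed (auto simp: mpower_series_ring_def)
qed

section \<open>Power and Laurent series over a field\<close>

text \<open>The common core of inversion and root extraction for power series: an equation \<open>\<Phi> f = a\<close> is solvable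
  if its \<open>m\<close>-th coefficient can be adjusted through \<open>f m\<close> alone, whatever the later coefficients are.\<close>

lemma coefficient_recursion:
  fixes \<Phi> :: "(nat \<Rightarrow> 'a) \<Rightarrow> nat \<Rightarrow> 'b" and C :: "nat \<Rightarrow> 'a set"
  assumes nonempty: "\<And>m. C m \<noteq> {}"
    and step: "\<And>m f. \<forall>i. f i \<in> C i \<Longrightarrow>
      \<exists>c\<in>C m. \<forall>h. (\<forall>i. h i \<in> C i) \<and> (\<forall>i<m. h i = f i) \<and> h m = c \<longrightarrow> \<Phi> h m = a m"
  obtains f where "\<And>i. f i \<in> C i" "\<And>m. \<Phi> f m = a m"
proof -
  have "\<exists>f. \<forall>m. f m \<in> C m \<and>
      (\<forall>h. (\<forall>i. h i \<in> C i) \<and> (\<forall>i<m. h i = f i) \<and> h m = f m \<longrightarrow> \<Phi> h m = a m)"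
  proof (rule dependent_wellorder_choice)
    fix m :: nat and f
    assume f: "\<And>i. i < m \<Longrightarrow> f i \<in> C i \<and>
      (\<forall>h. (\<forall>j. h j \<in> C j) \<and> (\<forall>j<i. h j = f j) \<and> h i = f i \<longrightarrow> \<Phi> h i = a i)"
    \<comment> \<open>The hypothesis \<open>step\<close> speaks of a complete sequence, while only
      the coefficients below \<open>m\<close> are chosen so far; the rest is filled with arbitrary
      admissible values.\<close>
    define f' where "f' i = (if i < m then f i else SOME c. c \<in> C i)" for i
    have "\<forall>i. f' i \<in> C i"
      using f nonempty by (auto simp: f'_def some_in_eq)
    from step[OF this, of m] show "\<exists>c. c \<in> C m \<and>
        (\<forall>h. (\<forall>i. h i \<in> C i) \<and> (\<forall>i<m. h i = f i) \<and> h m = c \<longrightarrow> \<Phi> h m = a m)"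
      by (auto simp: f'_def)
  qed simp
  then obtain f where f: "\<And>m. f m \<in> C m"
     "\<And>m h. (\<forall>i. h i \<in> C i) \<and> (\<forall>i<m. h i = f i) \<and> h m = f m \<Longrightarrow> \<Phi> h m = a m"
    by blast
  show ?thesis
    using that[of f] f(1) f(2)[of f] by simp
qed

lemma (in series_ring) minus_coeff:
  assumes "f \<in> carrier S" "g \<in> carrier S"
  shows "(f \<ominus>\<^bsub>S\<^esub> g) u = f u \<ominus> g u"
proof -
  have "\<ominus>\<^bsub>S\<^esub> g \<oplus>\<^bsub>S\<^esub> g = \<zero>\<^bsub>S\<^esub>"
    using assms by (simp add: S.l_neg)
  then have "(\<ominus>\<^bsub>S\<^esub> g) u \<oplus> g u = \<zero>"
    unfolding add_S zero_S by (rule fun_cong)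
  then have "(\<ominus>\<^bsub>S\<^esub> g) u = \<ominus> g u"
    using coeff_closed[OF assms(2)] coeff_closed[OF S.a_inv_closed[OF assms(2)]]
    by (intro R.minus_equality[symmetric]) auto
  then show ?thesis
    by (simp add: S.minus_eq R.minus_eq add_S)
qed

locale field_series = field R for R (structure)
begin

sublocale P: series_ring R "power_series_ring R" UNIV
  by (rule series_ring_power_series_ring) (rule is_cring)

sublocale L: series_ring R "laurent_series_ring R" "{A. \<exists>N. \<forall>i\<in>A. N \<le> i}"
  by (rule series_ring_laurent_series_ring) (rule is_cring)

sublocale L: domain "laurent_series_ring R"
  by (rule L.domain_S) (rule domain_axioms)

abbreviation "P \<equiv> power_series_ring R"
abbreviation "L \<equiv> laurent_series_ring R"

lemma carrier_P: "carrier P = {f. \<forall>i. f i \<in> carrier R}"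
  by (simp add: power_series_ring_def)

text \<open>This is the product rule f f' - h h' = (f - h) f' + h (f' - h'). The differences vanish
  below \<open>m\<close>, so at \<open>m\<close> each product contributes only its leading
  coefficient, taken at m + 0 and at 0 + m.\<close>

lemma mult_perturb:
  assumes c: "f \<in> carrier P" "f' \<in> carrier P" "h \<in> carrier P" "h' \<in> carrier P"
    and eq: "\<And>w. w < m \<Longrightarrow> f w = h w" "\<And>w. w < m \<Longrightarrow> f' w = h' w"
  shows "w < m \<Longrightarrow> (f \<otimes>\<^bsub>P\<^esub> f') w = (h \<otimes>\<^bsub>P\<^esub> h') w"
    and "(f \<otimes>\<^bsub>P\<^esub> f') m \<ominus> (h \<otimes>\<^bsub>P\<^esub> h') m = (f m \<ominus> h m) \<otimes> f' 0 \<oplus> h 0 \<otimes> (f' m \<ominus> h' m)"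
proof -
  note cc = P.coeff_closed[OF c(1)] P.coeff_closed[OF c(2)] P.coeff_closed[OF c(3)] P.coeff_closed[OF c(4)]
  have split: "f \<otimes>\<^bsub>P\<^esub> f' \<ominus>\<^bsub>P\<^esub> h \<otimes>\<^bsub>P\<^esub> h' =
      (f \<ominus>\<^bsub>P\<^esub> h) \<otimes>\<^bsub>P\<^esub> f' \<oplus>\<^bsub>P\<^esub> h \<otimes>\<^bsub>P\<^esub> (f' \<ominus>\<^bsub>P\<^esub> h')"
    using c by algebra
  have d: "(f \<otimes>\<^bsub>P\<^esub> f') w \<ominus> (h \<otimes>\<^bsub>P\<^esub> h') w =
      ((f \<ominus>\<^bsub>P\<^esub> h) \<otimes>\<^bsub>P\<^esub> f') w \<oplus> (h \<otimes>\<^bsub>P\<^esub> (f' \<ominus>\<^bsub>P\<^esub> h')) w" for w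
    using fun_cong[OF split, of w] c by (simp add: P.minus_coeff) (simp add: P.add_S)
  have v1: "(f \<ominus>\<^bsub>P\<^esub> h) w = \<zero>" if "w < m" for w
    using eq(1)[OF that] cc by (simp add: P.minus_coeff c r_right_minus_eq)
  have v2: "(f' \<ominus>\<^bsub>P\<^esub> h') w = \<zero>" if "w < m" for w
    using eq(2)[OF that] cc by (simp add: P.minus_coeff c r_right_minus_eq)
  have l1: "((f \<ominus>\<^bsub>P\<^esub> h) \<otimes>\<^bsub>P\<^esub> f') m = (f m \<ominus> h m) \<otimes> f' 0"
    "w < m \<Longrightarrow> ((f \<ominus>\<^bsub>P\<^esub> h) \<otimes>\<^bsub>P\<^esub> f') w = \<zero>" for w
    using P.leading_coeff_mult[of "f \<ominus>\<^bsub>P\<^esub> h" f' m 0, OF _ c(2) v1] c by (simp_all add: P.minus_coeff)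
  have l2: "(h \<otimes>\<^bsub>P\<^esub> (f' \<ominus>\<^bsub>P\<^esub> h')) m = h 0 \<otimes> (f' m \<ominus> h' m)"
    "w < m \<Longrightarrow> (h \<otimes>\<^bsub>P\<^esub> (f' \<ominus>\<^bsub>P\<^esub> h')) w = \<zero>" for w
    using P.leading_coeff_mult[of h "f' \<ominus>\<^bsub>P\<^esub> h'" 0 m, OF c(3) _ _ v2] c by (simp_all add: P.minus_coeff)
  show "(f \<otimes>\<^bsub>P\<^esub> f') m \<ominus> (h \<otimes>\<^bsub>P\<^esub> h') m = (f m \<ominus> h m) \<otimes> f' 0 \<oplus> h 0 \<otimes> (f' m \<ominus> h' m)"
    by (simp add: d l1 l2)
  show "(f \<otimes>\<^bsub>P\<^esub> f') w = (h \<otimes>\<^bsub>P\<^esub> h') w" if "w < m"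
    using d[of w] l1(2)[OF that] l2(2)[OF that] c P.coeff_closed[of "f \<otimes>\<^bsub>P\<^esub> f'" w] P.coeff_closed[of "h \<otimes>\<^bsub>P\<^esub> h'" w]
    by (simp add: r_right_minus_eq)
qed

text \<open>Iterating the product rule with constant terms 1 adds one copy of the change
  \<open>f m \<ominus> h m\<close> for each factor, just as the derivative of the n-th power at 1 is
  n.\<close>

lemma pow_perturb:
  assumes c: "f \<in> carrier P" "h \<in> carrier P" and one: "f 0 = \<one>" "h 0 = \<one>"
    and eq: "\<And>w. w < m \<Longrightarrow> f w = h w"
  shows "(\<forall>w<m. (f [^]\<^bsub>P\<^esub> n) w = (h [^]\<^bsub>P\<^esub> n) w) \<and>
    (f [^]\<^bsub>P\<^esub> n) m \<ominus> (h [^]\<^bsub>P\<^esub> n) m = add_pow R (n::nat) (f m \<ominus> h m)"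
proof (induction n)
  case 0
  show ?case
    using P.coeff_closed[OF P.S.one_closed] by (simp add: r_right_minus_eq)
next
  case (Suc n)
  have fn: "f [^]\<^bsub>P\<^esub> n \<in> carrier P" "h [^]\<^bsub>P\<^esub> n \<in> carrier P"
    using c by auto
  have d: "f m \<ominus> h m \<in> carrier R"
    using c P.coeff_closed by blast
  have h0: "(h [^]\<^bsub>P\<^esub> n) 0 = \<one>"
    using P.leading_coeff_pow[OF c(2), of 0 n] one by simp
  have IH: "\<And>w. w < m \<Longrightarrow> (f [^]\<^bsub>P\<^esub> n) w = (h [^]\<^bsub>P\<^esub> n) w"
    "(f [^]\<^bsub>P\<^esub> n) m \<ominus> (h [^]\<^bsub>P\<^esub> n) m = add_pow R n (f m \<ominus> h m)"
    using Suc by auto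
  show ?case
    using mult_perturb[OF fn(1) c(1) fn(2) c(2) IH(1) eq] d one h0
    by (simp add: IH(2) add.nat_pow_Suc)
qed

text \<open>Altering \<open>g m\<close> shifts the m-th coefficient of the product by
  \<open>f 0\<close> times the alteration, and \<open>f 0\<close> is invertible.\<close>

lemma power_series_inverse:
  assumes "f \<in> carrier P" "f 0 \<noteq> \<zero>"
  obtains g where "g \<in> carrier P" "f \<otimes>\<^bsub>P\<^esub> g = \<one>\<^bsub>P\<^esub>"
proof -
  have f0: "f 0 \<in> carrier R" "inv (f 0) \<in> carrier R" "f 0 \<otimes> inv (f 0) = \<one>"
    using P.coeff_closed[OF assms(1)] assms(2) by (auto simp: field_Units)
  obtain g where g: "\<And>i. g i \<in> carrier R" "\<And>m. (f \<otimes>\<^bsub>P\<^esub> g) m = \<one>\<^bsub>P\<^esub> m"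
  proof (rule coefficient_recursion[of "\<lambda>_. carrier R" "\<lambda>g. f \<otimes>\<^bsub>P\<^esub> g" "\<one>\<^bsub>P\<^esub>"])
    fix m and g :: "nat \<Rightarrow> 'a" assume g: "\<forall>i. g i \<in> carrier R"
    then have gP: "g \<in> carrier P" by (simp add: carrier_P)
    note cl = P.coeff_closed[OF P.S.m_closed[OF assms(1) gP], of m] P.coeff_closed[OF P.S.one_closed, of m]
    \<comment> \<open>The correction is the present error at \<open>m\<close> divided by
      \<open>f 0\<close>.\<close>
    define c where "c = g m \<oplus> inv (f 0) \<otimes> (\<one>\<^bsub>P\<^esub> m \<ominus> (f \<otimes>\<^bsub>P\<^esub> g) m)"
    have c: "c \<in> carrier R"
      unfolding c_def using g f0 cl by simp
    moreover have "(f \<otimes>\<^bsub>P\<^esub> h) m = \<one>\<^bsub>P\<^esub> m"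
      if h: "\<forall>i. h i \<in> carrier R" "\<forall>i<m. h i = g i" "h m = c" for h
    proof -
      have hP: "h \<in> carrier P" using h by (simp add: carrier_P)
      note cl' = P.coeff_closed[OF P.S.m_closed[OF assms(1) hP], of m]
      have "(f \<otimes>\<^bsub>P\<^esub> h) m \<ominus> (f \<otimes>\<^bsub>P\<^esub> g) m = (f m \<ominus> f m) \<otimes> h 0 \<oplus> f 0 \<otimes> (h m \<ominus> g m)"
        by (rule mult_perturb(2)) (use h assms(1) hP gP in auto)
      also have "\<dots> = f 0 \<otimes> (h m \<ominus> g m)"
        using g h(1) f0 P.coeff_closed[OF assms(1), of m] by (simp add: minus_eq r_neg)
      also have "h m \<ominus> g m = inv (f 0) \<otimes> (\<one>\<^bsub>P\<^esub> m \<ominus> (f \<otimes>\<^bsub>P\<^esub> g) m)"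
        unfolding h(3) c_def using g f0 cl by algebra
      also have "f 0 \<otimes> (inv (f 0) \<otimes> (\<one>\<^bsub>P\<^esub> m \<ominus> (f \<otimes>\<^bsub>P\<^esub> g) m)) = \<one>\<^bsub>P\<^esub> m \<ominus> (f \<otimes>\<^bsub>P\<^esub> g) m"
        using f0 cl by (simp flip: m_assoc)
      finally show ?thesis
        using cl cl' by (simp add: minus_eq)
    qed
    ultimately show "\<exists>c\<in>carrier R. \<forall>h. (\<forall>i. h i \<in> carrier R) \<and> (\<forall>i<m. h i = g i) \<and> h m = c \<longrightarrow>
        (f \<otimes>\<^bsub>P\<^esub> h) m = \<one>\<^bsub>P\<^esub> m"
      by blast
  qed auto
  show ?thesis
    by (rule that[of g]) (use g in \<open>auto simp: carrier_P\<close>)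
qed

text \<open>By \<open>pow_perturb\<close>, altering \<open>g m\<close> for m > 0 shifts the m-th
  coefficient of the power by \<open>n\<close> times the alteration, and \<open>n\<close> is
  invertible in the field.\<close>

lemma power_series_root:
  assumes "f \<in> carrier P" "f 0 = \<one>" "add_pow R (n::nat) \<one> \<noteq> \<zero>"
  obtains g where "g \<in> carrier P" "g [^]\<^bsub>P\<^esub> n = f"
proof -
  \<comment> \<open>Fixing the constant term at 1 is what makes \<open>pow_perturb\<close>
    applicable; coefficient 0 of the power is then 1 = \<open>f 0\<close> without any
    adjustment.\<close>
  let ?C = "\<lambda>i::nat. if i = 0 then {\<one>} else carrier R"
  let ?n = "add_pow R n \<one>"
  have n: "?n \<in> carrier R" "inv ?n \<in> carrier R" "?n \<otimes> inv ?n = \<one>"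
    using assms(3) by (auto simp: field_Units)
  obtain g where g: "\<And>i. g i \<in> ?C i" "\<And>m. (g [^]\<^bsub>P\<^esub> n) m = f m"
  proof (rule coefficient_recursion[of ?C "\<lambda>g. g [^]\<^bsub>P\<^esub> n" f])
    fix m and g :: "nat \<Rightarrow> 'a" assume g: "\<forall>i. g i \<in> ?C i"
    have C: "h \<in> carrier P" "h 0 = \<one>" if h: "\<forall>i. h i \<in> ?C i" for h
    proof -
      have "h i \<in> carrier R" for i
        using h[rule_format, of i] by (cases "i = 0") auto
      then show "h \<in> carrier P" by (simp add: carrier_P)
      show "h 0 = \<one>"
        using h[rule_format, of 0] by simp
    qed
    have cl: "(h [^]\<^bsub>P\<^esub> n) m \<in> carrier R" "f m \<in> carrier R" "h m \<in> carrier R" if "\<forall>i. h i \<in> ?C i" for h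
      using P.coeff_closed[OF P.S.nat_pow_closed[OF C(1)[OF that]]] P.coeff_closed[OF assms(1)]
        P.coeff_closed[OF C(1)[OF that]] by auto
    show "\<exists>c\<in>?C m. \<forall>h. (\<forall>i. h i \<in> ?C i) \<and> (\<forall>i<m. h i = g i) \<and> h m = c \<longrightarrow> (h [^]\<^bsub>P\<^esub> n) m = f m"
    proof (cases "m = 0")
      case True
      have "(h [^]\<^bsub>P\<^esub> n) m = f m" if "\<forall>i. h i \<in> ?C i" for h
        using P.leading_coeff_pow[OF C(1)[OF that], of 0 n] C(2)[OF that] assms(2) True by simp
      then show ?thesis using True by auto
    next
      case False
      define c where "c = g m \<oplus> inv ?n \<otimes> (f m \<ominus> (g [^]\<^bsub>P\<^esub> n) m)"
      have c: "c \<in> ?C m"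
        unfolding c_def using n cl[OF g] False by simp
      moreover have "(h [^]\<^bsub>P\<^esub> n) m = f m"
        if h: "\<forall>i. h i \<in> ?C i" "\<forall>i<m. h i = g i" "h m = c" for h
      proof -
        have "(h [^]\<^bsub>P\<^esub> n) m \<ominus> (g [^]\<^bsub>P\<^esub> n) m = add_pow R n (h m \<ominus> g m)"
          using pow_perturb[OF C(1)[OF h(1)] C(1)[OF g] C(2)[OF h(1)] C(2)[OF g], of m n] h(2) by blast
        also have "h m \<ominus> g m = inv ?n \<otimes> (f m \<ominus> (g [^]\<^bsub>P\<^esub> n) m)"
          unfolding h(3) c_def using n cl[OF g] by algebra
        also have "add_pow R n \<dots> = ?n \<otimes> (inv ?n \<otimes> (f m \<ominus> (g [^]\<^bsub>P\<^esub> n) m))"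
          using n cl[OF g] by (subst add_pow_ldistr) auto
        also have "\<dots> = f m \<ominus> (g [^]\<^bsub>P\<^esub> n) m"
          using n cl[OF g] by (simp flip: m_assoc)
        finally show ?thesis
          using cl[OF g] cl[OF h(1)] by (simp add: minus_eq)
      qed
      ultimately show ?thesis by blast
    qed
  qed auto
  have "g i \<in> carrier R" for i
    using g(1)[of i] by (auto split: if_splits)
  then show ?thesis
    by (intro that[of g]) (use g(2) in \<open>auto simp: carrier_P\<close>)
qed

section \<open>Power series inside Laurent series\<close>

definition laurent_of_power :: "(nat \<Rightarrow> 'a) \<Rightarrow> int \<Rightarrow> 'a" where
  "laurent_of_power f = (\<lambda>i. if 0 \<le> i then f (nat i) else \<zero>)"

lemma laurent_of_power_hom: "laurent_of_power \<in> ring_hom P L"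
proof (rule ring_hom_memI)
  show c: "laurent_of_power f \<in> carrier L" if "f \<in> carrier P" for f
    using P.coeff_closed[OF that]
    by (intro L.carrierI[of _ "{0..}"]) (auto simp: laurent_of_power_def split: if_splits)
  fix f g assume fg: "f \<in> carrier P" "g \<in> carrier P"
  note cc = P.coeff_closed[OF fg(1)] P.coeff_closed[OF fg(2)]
  let ?f = "laurent_of_power f" and ?g = "laurent_of_power g"
  show "laurent_of_power (f \<otimes>\<^bsub>P\<^esub> g) = ?f \<otimes>\<^bsub>L\<^esub> ?g"
  proof
    fix u
    let ?I = "{p. fst p + snd p = u \<and> ?f (fst p) \<noteq> \<zero> \<and> ?g (snd p) \<noteq> \<zero>}"
    show "laurent_of_power (f \<otimes>\<^bsub>P\<^esub> g) u = (?f \<otimes>\<^bsub>L\<^esub> ?g) u"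
    proof (cases "0 \<le> u")
      case True
      let ?J = "{p. fst p + snd p = nat u \<and> f (fst p) \<noteq> \<zero> \<and> g (snd p) \<noteq> \<zero>}"
      have eq: "?I = map_prod int int ` ?J"
      proof
        show "map_prod int int ` ?J \<subseteq> ?I"
          using True by (auto simp: laurent_of_power_def)
        show "?I \<subseteq> map_prod int int ` ?J"
        proof
          fix p assume "p \<in> ?I"
          then show "p \<in> map_prod int int ` ?J"
            by (intro image_eqI[of _ _ "(nat (fst p), nat (snd p))"])
               (auto simp: laurent_of_power_def prod_eq_iff split: if_splits)
        qed
      qed
      show ?thesis
        unfolding L.mult_S[OF c[OF fg(1)] c[OF fg(2)]] eq using cc True
        by (subst finsum_reindex) (auto simp: laurent_of_power_def P.mult_S[OF fg] inj_on_def)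
    next
      case False
      then have "?I = {}"
        by (auto simp: laurent_of_power_def)
      then show ?thesis
        unfolding L.mult_S[OF c[OF fg(1)] c[OF fg(2)]] \<open>?I = {}\<close> using False by (simp add: laurent_of_power_def)
    qed
  qed
qed (auto simp: laurent_of_power_def P.add_S L.add_S P.one_S L.one_S)

lemma laurent_of_power_surj:
  assumes "f \<in> carrier L" "\<And>i. i < 0 \<Longrightarrow> f i = \<zero>"
  obtains p where "p \<in> carrier P" "laurent_of_power p = f" "p 0 = f 0"
proof (rule that)
  show "(\<lambda>i. f (int i)) \<in> carrier P"
    using L.coeff_closed[OF assms(1)] by (simp add: carrier_P)
  show "laurent_of_power (\<lambda>i. f (int i)) = f"
    using assms(2) by (auto simp: laurent_of_power_def fun_eq_iff)
qed simp

lemma laurent_of_power_inj: "laurent_of_power f = laurent_of_power g \<Longrightarrow> f = g"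
proof
  fix i assume "laurent_of_power f = laurent_of_power g"
  from fun_cong[OF this, of "int i"] show "f i = g i"
    by (simp add: laurent_of_power_def)
qed

sublocale e: ring_hom_cring P L laurent_of_power
  by (intro ring_hom_cring.intro P.cring_S L.cring_S) (simp add: ring_hom_cring_axioms_def laurent_of_power_hom)

definition monomial :: "int \<Rightarrow> int \<Rightarrow> 'a" where
  "monomial v = (\<lambda>i. if i = v then \<one> else \<zero>)"

lemma monomial_closed: "monomial v \<in> carrier L"
  by (rule L.carrierI[of _ "{v..}"]) (auto simp: monomial_def split: if_splits)

lemma monomial_simps [simp]: "monomial v v = \<one>" "w < v \<Longrightarrow> monomial v w = \<zero>"
  by (auto simp: monomial_def)

text \<open>Multiplication by the monomial of exponent \<open>-u\<close> moves the leading exponent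
  to 0. The result is a power series with nonzero constant term, which is inverted there, and the
  monomial is moved into the inverse.\<close>

lemma field_L: "field L"
proof (rule L.S.cring_fieldI2)
  show "\<zero>\<^bsub>L\<^esub> \<noteq> \<one>\<^bsub>L\<^esub>" using L.one_not_zero by simp
  fix f assume f: "f \<in> carrier L" "f \<noteq> \<zero>\<^bsub>L\<^esub>"
  then obtain u where u: "f u \<noteq> \<zero>" "\<And>w. w < u \<Longrightarrow> f w = \<zero>"
    using L.ex_leading by blast
  have t: "(monomial (-u) \<otimes>\<^bsub>L\<^esub> f) 0 = f u" "w < 0 \<Longrightarrow> (monomial (-u) \<otimes>\<^bsub>L\<^esub> f) w = \<zero>" for w
    using L.leading_coeff_mult[of "monomial (-u)" f "-u" u, OF monomial_closed f(1) _ u(2)]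
      L.coeff_closed[OF f(1), of u] by simp_all
  obtain p where p: "p \<in> carrier P" "laurent_of_power p = monomial (-u) \<otimes>\<^bsub>L\<^esub> f" "p 0 = f u"
    using laurent_of_power_surj[OF L.S.m_closed[OF monomial_closed f(1)]] t by metis
  obtain q where q: "q \<in> carrier P" "p \<otimes>\<^bsub>P\<^esub> q = \<one>\<^bsub>P\<^esub>"
    using power_series_inverse[OF p(1)] u(1) p(3) by auto
  have "laurent_of_power p \<otimes>\<^bsub>L\<^esub> laurent_of_power q = \<one>\<^bsub>L\<^esub>"
    using e.hom_mult[OF p(1) q(1)] by (simp add: q(2))
  then have "f \<otimes>\<^bsub>L\<^esub> (monomial (-u) \<otimes>\<^bsub>L\<^esub> laurent_of_power q) = \<one>\<^bsub>L\<^esub>"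
    unfolding p(2) using f monomial_closed q(1) by (simp add: L.S.m_ac)
  then show "\<exists>g\<in>carrier L. f \<otimes>\<^bsub>L\<^esub> g = \<one>\<^bsub>L\<^esub>"
    using monomial_closed q(1) by blast
qed

end

section \<open>Waring numbers of Laurent series\<close>

context field_series
begin

text \<open>Taking the constant term is a ring homomorphism that undoes the embedding of
  constants.\<close>

lemma waring_number_le_power_series: "waring_number n R \<le> waring_number n P"
proof (rule waring_number_retract_le[OF is_cring P.cring_S P.const_series_hom])
  show "(\<lambda>f. f 0) \<in> ring_hom P R"
  proof (rule ring_hom_memI)
    show "(f \<otimes>\<^bsub>P\<^esub> g) 0 = f 0 \<otimes> g 0" if "f \<in> carrier P" "g \<in> carrier P" for f g
      using P.leading_coeff_mult[OF that, of 0 0] by simp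
  qed (auto simp: P.coeff_closed P.add_S P.one_S)
qed (simp add: P.const_series_def)

lemma waring_number_power_series_le_laurent:
  assumes "npow_anisotropic n R" "0 < n"
  shows "waring_number n P \<le> waring_number n L"
proof (rule waring_number_le)
  fix m b assume b: "sum_of_npowers P n m b"
  have bP: "b \<in> carrier P"
    by (rule sum_of_npowers_carrier[OF P.cring_S b])
  have "sum_of_npowers P n g b" if "sum_of_npowers L n g (laurent_of_power b)" for g
  proof -
    from that obtain f where f: "f \<in> {..<g} \<rightarrow> carrier L"
      "laurent_of_power b = (\<Oplus>\<^bsub>L\<^esub>i\<in>{..<g}. f i [^]\<^bsub>L\<^esub> n)"
      unfolding sum_of_npowers_def by blast
    have "\<exists>p\<in>carrier P. laurent_of_power p = f i" if i: "i < g" for i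
    proof -
      have fi: "f i \<in> carrier L" using f(1) i by auto
      have "f i w = \<zero>" if w: "w < 0" for w
      proof (rule ccontr)
        assume nz: "f i w \<noteq> \<zero>"
        then have "\<exists>i<g. f i \<noteq> \<zero>\<^bsub>L\<^esub>"
          using i by (auto simp: L.zero_S)
        then obtain u j where j: "j < g" "f j u \<noteq> \<zero>" and u: "\<And>i w. i < g \<Longrightarrow> w < u \<Longrightarrow> f i w = \<zero>"
          using L.ex_leading_family[OF f(1)] by metis
        \<comment> \<open>The least exponent of the whole family is at most the supposed negative
          exponent \<open>w\<close>. As \<open>n\<close> is positive, n u is negative too, and there
          the embedded power series has coefficient zero.\<close>
        have "u < 0"
          using u[OF i, of w] nz w by (metis linorder_not_less order_le_less_trans)
        then have neg: "(\<Sum>_<n. u) < 0"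
          using assms(2) by (simp add: mult_pos_neg)
        have "(\<Oplus>i\<in>{..<g}. f i u [^] n) = laurent_of_power b (\<Sum>_<n. u)"
          unfolding f(2) by (rule L.leading_coeff_sum_pow(1)[OF f(1), symmetric]) (simp add: u)
        also have "\<dots> = \<zero>"
          using neg by (simp add: laurent_of_power_def)
        finally have "(\<Oplus>i\<in>{..<g}. f i u [^] n) = \<zero>" .
        moreover have "(\<lambda>i. f i u) \<in> {..<g} \<rightarrow> carrier R"
          using f(1) by (auto intro: L.coeff_closed)
        ultimately show False
          using npow_anisotropicD[OF assms(1) _ _ j(1), of "\<lambda>i. f i u"] j(2) by blast
      qed
      with fi show ?thesis using laurent_of_power_surj by metis
    qed
    then obtain p where p: "\<And>i. i < g \<Longrightarrow> p i \<in> carrier P" "\<And>i. i < g \<Longrightarrow> laurent_of_power (p i) = f i"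
      by metis
    have "laurent_of_power (\<Oplus>\<^bsub>P\<^esub>i\<in>{..<g}. p i [^]\<^bsub>P\<^esub> n) =
        (\<Oplus>\<^bsub>L\<^esub>i\<in>{..<g}. laurent_of_power (p i) [^]\<^bsub>L\<^esub> n)"
      using p(1) by (subst e.hom_finsum) (auto intro!: L.S.finsum_cong')
    also have "\<dots> = laurent_of_power b"
      unfolding f(2) using p f(1) by (intro L.S.finsum_cong') auto
    finally have "(\<Oplus>\<^bsub>P\<^esub>i\<in>{..<g}. p i [^]\<^bsub>P\<^esub> n) = b"
      by (rule laurent_of_power_inj)
    then show ?thesis
      unfolding sum_of_npowers_def using p(1) by (intro bexI[of _ p]) auto
  qed
  then show "\<exists>a. (\<exists>m. sum_of_npowers L n m a) \<and>
      (\<forall>g. sum_of_npowers L n g a \<longrightarrow> (\<exists>m\<le>g. sum_of_npowers P n m b))"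
    using sum_of_npowers_hom[OF P.cring_S L.cring_S laurent_of_power_hom b] by blast
qed

text \<open>The companion of \<open>b\<close> is its leading coefficient \<open>a\<close>: since
  \<open>b\<close> is \<open>a\<close> times an n-th power in \<open>L\<close>, every representation
  of \<open>a\<close> over the field yields one of \<open>b\<close> with the same number of
  terms.\<close>

lemma waring_number_laurent_le:
  assumes "npow_anisotropic n R" "0 < n"
  shows "waring_number n L \<le> waring_number n R"
proof (rule waring_number_le)
  interpret LF: field L by (rule field_L)
  fix m b assume "sum_of_npowers L n m b"
  then obtain f where f: "f \<in> {..<m} \<rightarrow> carrier L" "b = (\<Oplus>\<^bsub>L\<^esub>i\<in>{..<m}. f i [^]\<^bsub>L\<^esub> n)"
    unfolding sum_of_npowers_def by blast
  have bL: "b \<in> carrier L"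
    unfolding f(2) using f(1) by (auto intro!: L.S.finsum_closed)
  show "\<exists>a. (\<exists>m. sum_of_npowers R n m a) \<and>
      (\<forall>g. sum_of_npowers R n g a \<longrightarrow> (\<exists>m\<le>g. sum_of_npowers L n m b))"
  proof (cases "\<exists>i<m. f i \<noteq> \<zero>\<^bsub>L\<^esub>")
    \<comment> \<open>Without a nonzero term there is no leading coefficient. Here \<open>b\<close>
      is zero, which is the empty sum in both rings.\<close>
    case False
    then have "b = (\<Oplus>\<^bsub>L\<^esub>i\<in>{..<m}. \<zero>\<^bsub>L\<^esub>)"
      unfolding f(2) using assms(2) by (intro L.S.finsum_cong') (auto simp: L.S.nat_pow_zero)
    then have "sum_of_npowers L n 0 b"
      by (simp add: sum_of_npowers_def)
    moreover have "sum_of_npowers R n 0 \<zero>"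
      by (simp add: sum_of_npowers_def)
    ultimately show ?thesis by blast
  next
    case True
    then obtain u j where j: "j < m" "f j u \<noteq> \<zero>" and u: "\<And>i w. i < m \<Longrightarrow> w < u \<Longrightarrow> f i w = \<zero>"
      using L.ex_leading_family[OF f(1)] by metis
    define a where "a = (\<Oplus>i\<in>{..<m}. f i u [^] n)"
    have fu: "(\<lambda>i. f i u) \<in> {..<m} \<rightarrow> carrier R"
      using f(1) by (auto intro: L.coeff_closed)
    have aR: "a \<in> carrier R"
      unfolding a_def using fu by (auto intro!: finsum_closed)
    have a0: "a \<noteq> \<zero>"
      using npow_anisotropicD[OF assms(1) fu _ j(1)] j(2) by (auto simp: a_def)
    have a: "sum_of_npowers R n m a"
      unfolding sum_of_npowers_def a_def using fu by (intro bexI[of _ "\<lambda>i. f i u"]) auto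
    have b: "b (\<Sum>_<n. u) = a"
      unfolding f(2) a_def by (rule L.leading_coeff_sum_pow(1)[OF f(1)]) (simp add: u)
    have b': "b w = \<zero>" if "w < (\<Sum>_<n. u)" for w
      unfolding f(2) by (rule L.leading_coeff_sum_pow(2)[OF f(1) _ that]) (simp add: u)
    have char: "add_pow R n \<one> \<noteq> \<zero>"
      using char_zero_if_npow_anisotropic[OF assms(1) _ assms(2)] by simp
    \<comment> \<open>\<open>M\<close> is the monomial of exponent -n u, kept as an n-th power so
      that it can later be undone by an n-th power.\<close>
    define M where "M = monomial (-u) [^]\<^bsub>L\<^esub> n"
    have M: "M \<in> carrier L"
      unfolding M_def using monomial_closed by simp
    have Mc: "M (\<Sum>_<n. -u) = \<one>" "w < (\<Sum>_<n. -u) \<Longrightarrow> M w = \<zero>" for w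
      unfolding M_def using L.leading_coeff_pow[OF monomial_closed, of "-u" "-u" n] by simp_all
    define c where "c = L.const_series a"
    have c: "c \<in> carrier L" "c \<noteq> \<zero>\<^bsub>L\<^esub>"
      using ring_hom_closed[OF L.const_series_hom aR] a0
      by (auto simp: c_def L.const_series_def L.zero_S dest: fun_cong[where x = 0])
    define d where "d = L.const_series (inv a)"
    have inv: "inv a \<in> carrier R" "a \<otimes> inv a = \<one>" "inv a \<otimes> a = \<one>"
      using aR a0 by (auto simp: field_Units)
    have d: "d \<in> carrier L" "c \<otimes>\<^bsub>L\<^esub> d = \<one>\<^bsub>L\<^esub>"
      using ring_hom_closed[OF L.const_series_hom inv(1)] ring_hom_mult[OF L.const_series_hom aR inv(1)]
        ring_hom_one[OF L.const_series_hom] inv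
      by (auto simp: c_def d_def)
    \<comment> \<open>Shifting \<open>b\<close> by \<open>M\<close> and dividing by its leading
      coefficient leaves a series with constant term 1 and no negative exponents, as root extraction
      requires.\<close>
    define t where "t = d \<otimes>\<^bsub>L\<^esub> (M \<otimes>\<^bsub>L\<^esub> b)"
    have t: "t \<in> carrier L"
      unfolding t_def using d M bL by simp
    have Mb: "M \<otimes>\<^bsub>L\<^esub> b \<in> carrier L"
      using M bL by simp
    have Mbc: "(M \<otimes>\<^bsub>L\<^esub> b) 0 = a" "w < 0 \<Longrightarrow> (M \<otimes>\<^bsub>L\<^esub> b) w = \<zero>" for w
      using L.leading_coeff_mult[of M b "\<Sum>_<n. -u" "\<Sum>_<n. u", OF M bL Mc(2) b'] Mc(1) b aR
      by simp_all
    have tw: "t w = inv a \<otimes> (M \<otimes>\<^bsub>L\<^esub> b) w" for w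
      unfolding t_def d_def using L.const_mult_coeff[OF inv(1) Mb] by (simp add: L.const_series_def)
    have t0: "t 0 = \<one>" "w < 0 \<Longrightarrow> t w = \<zero>" for w
      using tw Mbc inv by simp_all
    obtain p where p: "p \<in> carrier P" "laurent_of_power p = t" "p 0 = \<one>"
      using laurent_of_power_surj[OF t] t0 by metis
    obtain q where q: "q \<in> carrier P" "q [^]\<^bsub>P\<^esub> n = p"
      using power_series_root[OF p(1,3) char] by blast
    \<comment> \<open>With \<open>q\<close> an n-th root of \<open>t\<close> as a power series,
      \<open>y\<close> is x to the \<open>u\<close> times \<open>q\<close>, so the product of its
      n-th power with the constant \<open>c\<close> is \<open>b\<close>.\<close>
    define y where "y = inv\<^bsub>L\<^esub> (monomial (-u)) \<otimes>\<^bsub>L\<^esub> laurent_of_power q"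
    have "monomial (-u) \<noteq> \<zero>\<^bsub>L\<^esub>"
      by (auto simp: monomial_def L.zero_S dest: fun_cong[where x = "-u"])
    then have mon: "monomial (-u) \<in> Units L"
      using monomial_closed by (simp add: LF.field_Units)
    have y: "y \<in> carrier L"
      unfolding y_def using mon q by simp
    have "y [^]\<^bsub>L\<^esub> n \<otimes>\<^bsub>L\<^esub> c = inv\<^bsub>L\<^esub> (monomial (-u)) [^]\<^bsub>L\<^esub> n \<otimes>\<^bsub>L\<^esub> t \<otimes>\<^bsub>L\<^esub> c"
      unfolding y_def using mon q p by (simp add: L.S.nat_pow_distrib flip: e.hom_pow)
    also have "\<dots> = (inv\<^bsub>L\<^esub> (monomial (-u)) [^]\<^bsub>L\<^esub> n \<otimes>\<^bsub>L\<^esub> monomial (-u) [^]\<^bsub>L\<^esub> n) \<otimes>\<^bsub>L\<^esub> ((c \<otimes>\<^bsub>L\<^esub> d) \<otimes>\<^bsub>L\<^esub> b)"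
      unfolding t_def M_def using mon monomial_closed c(1) d(1) bL by (simp add: L.S.m_ac)
    also have "\<dots> = b"
      using mon monomial_closed bL by (simp add: d(2) flip: L.S.nat_pow_distrib)
    finally have yb: "y [^]\<^bsub>L\<^esub> n \<otimes>\<^bsub>L\<^esub> c = b" .
    have "sum_of_npowers L n g b" if "sum_of_npowers R n g a" for g
      using L.S.sum_of_npowers_mult[OF sum_of_npowers_hom[OF is_cring L.cring_S L.const_series_hom that] y]
      unfolding c_def[symmetric] yb .
    with a show ?thesis by blast
  qed
qed

end

text \<open>The three inequalities run from the field to power series, to Laurent series and back to
  the field, so all are equalities.\<close>

lemma waring_number_laurent_eq:
  assumes "field R" "npow_anisotropic n R" "0 < n"
  shows "waring_number n (power_series_ring R) = waring_number n R"
    and "waring_number n (laurent_series_ring R) = waring_number n R"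
proof -
  interpret field R by fact
  interpret field_series R ..
  note le = waring_number_le_power_series[of n] waring_number_power_series_le_laurent[OF assms(2,3)]
    waring_number_laurent_le[OF assms(2,3)]
  show "waring_number n P = waring_number n R" "waring_number n L = waring_number n R"
    using le by order+
qed

text \<open>Each stage of \<open>iterated_laurent\<close> is an injectively encoded copy of a ring;
  the encoding is a ring isomorphism and so preserves all the data on which the induction
  relies.\<close>

lemma image_ring_invariants:
  assumes A: "field A" "npow_anisotropic n A" and h: "inj h"
  shows "field (image_ring h A)" "npow_anisotropic n (image_ring h A)"
    "waring_number n (image_ring h A) = waring_number n A"
proof -
  interpret A: field A by fact
  have inj: "inj_on h (carrier A)" using h by (rule inj_on_subset) simp
  show fld: "field (image_ring h A)"
    by (rule A.inj_imp_image_ring_is_field[OF inj])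
  then interpret B: field "image_ring h A" .
  have iso: "h \<in> ring_iso A (image_ring h A)"
    by (rule inj_imp_image_ring_iso[OF inj])
  let ?h' = "inv_into (carrier A) h"
  have iso': "?h' \<in> ring_iso (image_ring h A) A"
    by (rule ring_iso_set_sym[OF A.ring_axioms iso])
  then have "?h' \<in> ring_hom (image_ring h A) A" "inj_on ?h' (carrier (image_ring h A))"
    by (auto simp: ring_iso_def bij_betw_def)
  then show "npow_anisotropic n (image_ring h A)"
    using npow_anisotropic_inj[OF B.is_cring A.is_cring _ _ A(2)] by blast
  show "waring_number n (image_ring h A) = waring_number n A"
    using waring_number_iso[OF A.is_cring B.is_cring iso] by simp
qed

text \<open>The three properties must be carried together: adjoining a further variable preserves
  the Waring number only over an anisotropic field, and it again produces such a field.\<close>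

lemma iterated_laurent_invariants:
  assumes "field k" "npow_anisotropic n k" "0 < n"
  shows "field (iterated_laurent k s) \<and> npow_anisotropic n (iterated_laurent k s) \<and>
    waring_number n (iterated_laurent k s) = waring_number n k"
proof (induction s)
  case 0
  show ?case
    using image_ring_invariants[OF assms(1,2) inj_const_coeff] by simp
next
  case (Suc s)
  let ?A = "iterated_laurent k s"
  from Suc have A: "field ?A" "npow_anisotropic n ?A" and eq: "waring_number n ?A = waring_number n k"
    by auto
  interpret A: field ?A by fact
  interpret field_series ?A ..
  show ?case
    using image_ring_invariants[OF field_L L.npow_anisotropic_S[OF A(2)] inj_cons_coeff]
      waring_number_laurent_eq(2)[OF A assms(3)] eq
    by simp
qed

theorem theorem6p2:
  fixes k :: "('a, 'm) ring_scheme" and n s :: nat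
  assumes "field k" and "0 < n" and "0 < s" and "nth_level n k = \<infinity>"
  shows "waring_number n (power_series_ring (iterated_laurent k (s - 1)))
           = waring_number n (iterated_laurent k s)
       \<and> waring_number n (iterated_laurent k s) = waring_number n k
       \<and> waring_number n (mpower_series_ring k s)
           \<ge> waring_number n (fraction_field (mpower_series_ring k s))
       \<and> waring_number n (fraction_field (mpower_series_ring k s)) \<ge> waring_number n k"
proof -
  interpret k: field k by fact
  have an: "npow_anisotropic n k"
    by (rule k.npow_anisotropic_if_level_infinite) fact+
  note it = iterated_laurent_invariants[OF assms(1) an assms(2)]
  interpret M: series_ring k "mpower_series_ring k s" "Pow {u. Poly_Mapping.keys u \<subseteq> {1..s}}"
    by (rule series_ring_mpower_series_ring) (rule k.is_cring)
  interpret M: domain "mpower_series_ring k s"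
    by (rule M.domain_S) (rule k.domain_axioms)
  \<comment> \<open>The last variable is adjoined by power series over the field in the other
    \<open>s - 1\<close> variables, which for s = 1 is the encoded copy of \<open>k\<close>.\<close>
  have "waring_number n (power_series_ring (iterated_laurent k (s - 1))) = waring_number n k"
    using it[of "s - 1"] waring_number_laurent_eq(1)[OF _ _ assms(2), of "iterated_laurent k (s - 1)"]
    by simp
  moreover have "waring_number n k \<le> waring_number n (fraction_field (mpower_series_ring k s))"
    by (rule M.waring_number_le_fraction_field) fact+
  ultimately show ?thesis
    using it[of s] M.waring_number_fraction_field_le[of n] by simp
qed

end
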